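(* Let $T$ be an $n$-string link with a fixed abstract closure $\sigma$ to an oriented circle and a fixed point $\infty\in\partial T$, and let $m$ be the meridian of a positive quadruple crossing. For each grading $A\subset\partial T$, the 1-cochain $$R_{F,reg}(m)(A)=\sum_{p\in m}\mathrm{sign}(p)\,\sigma_2\sigma_1(p)+\sum_{p\in m}\mathrm{sign}(p)\,W_A(p)\,(\sigma_2^2(p)-\sigma_1^2(p)),$$ with values in the Kauffman skein module of $\partial T$, is a solution of the positive global tetrahedron equation, i.e. $R_{F,reg}(m)(A)=0$ for every such $m$. Here the first sum is over all triple crossings $p$ in $m$ of global type $l_c$ or $r_a$ such that $\partial(hm)=A$, and the second sum is over all triple crossings $p$ in $m$ which have a distinguished crossing $d$ of type $0$ (global types $r_a,r_b,l_b$).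
   Context: Setting. An $n$-string link $T$ consists of $n$ ordered, oriented, properly and smoothly embedded arcs in the cube $I^3=I^2\times I$, considered via the orthogonal projection $pr:I^3\to I^2$. Abstract arcs $\sigma$ are added (not embedded) so that $T\cup\sigma$ is one oriented circle; $\infty$ is a point of $\partial T$ on this circle. The Kauffman skein module of $\partial T$ is the module over $\mathbb{Z}[v^{\pm1},z^{\pm1}]$ of unoriented tangle diagrams with boundary $\partial T$ up to regular isotopy modulo: (crossing) $+$ (opposite crossing) $=z\,\cdot$ (sum of the two smoothings), a positive (negative) kink contributes $v$ ($v^{-1}$), and a trivial component contributes $(v+v^{-1})/z-1$. Crossings. Starting at $\infty$ and following the oriented circle, a crossing $q$ is of type $1$ if its under-cross is met before its over-cross, and of type $0$ otherwise. For $q$ of type $1$, $D_q^+$ is the arc of the circle from the over-cross to the under-cross of $q$ (it contains $\infty$), and the grading of $q$ is $\partial q=D_q^+\cap\partial T$; gradings $A$ are cyclically ordered subsets of $\partial T$ with alternating signs containing $\infty$. $w(q)=\pm1$ is the writhe of $q$. Triple crossings. At a triple crossing $p$ the three branches are called low, mid, high according to height. The distinguished crossing $d$ is between low and high, $hm$ is between high and mid, $ml$ is between mid and low. The global type of $p$ is determined by the order in which the branches are met from $\infty$: $r_a$: mid, high, low; $r_b$: high, low, mid; $l_b$: high, mid, low; $l_c$: mid, low, high. When $d$ is of type $0$, an f-crossing of $p$ is a crossing $q\neq d$ of type $1$ whose under-cross lies on the oriented arc from $\infty$ to the over-cross of $d$; $W_A(p)=\sum w(q)$ over all f-crossings $q$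 with $\partial q=A$ (crossings of the triangle such as $hm$ are included if they satisfy the definition). Positive triple crossings and smoothings. Braid words are read in the direction of the orientation, and positions are numbered so that in the positive crossing $\sigma_i$ the strand going from position $i$ to $i+1$ is the under strand. A triple crossing is positive if its three crossings are positive; then its perturbations are $\sigma_1\sigma_2\sigma_1$ and $\sigma_2\sigma_1\sigma_2$, and the Reidemeister move $\sigma_1\sigma_2\sigma_1\to\sigma_2\sigma_1\sigma_2$ has sign $+1$, its inverse sign $-1$. For a 3-braid $\beta$, $\beta(p)$ is the element of the skein module obtained by replacing the triple crossing by $\beta$. Quadruple crossings. A positive quadruple crossing is a point where four branches $1,2,3,4$ (from lowest to highest) meet in one point of the projection, pairwise transversally, forming a braid with all six crossings positive after perturbation. Its meridian $m$ is the loop of diagrams which is constant outside the quadruple crossing and which inside passes (up to far commutation) through the eight positive Reidemeister III moves given, with their signs, by $P_3:[121\to212]321\,(+)$, $P_4:21[232\to323]1\,(+)$, $\bar P_1:23[121\to212]3\,(+)$, $\bar P_2:[232\to323]123\,(+)$, $\bar P_3:321[323\to232]\,(-)$, $\bar P_4:3[212\to121]32\,(-)$, $P_1:1[323\to232]12\,(-)$, $P_2:123[212\to121]\,(-)$, where $i$ stands for $\sigma_i$. No assumption is made on the order in which the circle passes the four branches or on the position of $\infty$. *)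

theory Defs
  imports Complex_Main "HOL-Library.Poly_Mapping" "HOL-Library.Product_Plus"
    "HOL-Combinatorics.Transposition"
begin

section \<open>Tangle diagrams\<close>

text \<open>
  A tangle diagram in the square, in general position with respect to the height function, is
  the list of its elementary slices from top to bottom. Between two slices the strands are
  numbered 1, 2, ... from left to right, and \<open>\<partial>T\<close> consists of the points on the top and on the
  bottom side.

  \<^item> \<open>Sig i\<close> crosses the strands \<open>i\<close> and \<open>i+1\<close>; the strand from \<open>i\<close> (above) to \<open>i+1\<close> (below)
    is the under strand. If both strands run downwards this is the positive crossing
    \<open>\<sigma>\<^sub>i\<close> of the braid group, read downwards. \<open>SigInv i\<close> is the opposite crossing.
  \<^item> \<open>Cap i\<close> is a local maximum, from which two new strands \<open>i\<close> and \<open>i+1\<close> hang down.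
  \<^item> \<open>Cup i\<close> is a local minimum, joining the strands \<open>i\<close> and \<open>i+1\<close>.
\<close>

datatype slice = Sig nat | SigInv nat | Cap nat | Cup nat

type_synonym diagram = "slice list"

fun slice_target :: "slice \<Rightarrow> nat \<Rightarrow> nat option" where
  "slice_target (Sig i) c = (if 1 \<le> i \<and> i + 1 \<le> c then Some c else None)"
| "slice_target (SigInv i) c = (if 1 \<le> i \<and> i + 1 \<le> c then Some c else None)"
| "slice_target (Cap i) c = (if 1 \<le> i \<and> i \<le> c + 1 then Some (c + 2) else None)"
| "slice_target (Cup i) c = (if 1 \<le> i \<and> i + 1 \<le> c then Some (c - 2) else None)"

fun target :: "nat \<Rightarrow> diagram \<Rightarrow> nat option" where
  "target c [] = Some c"
| "target c (s # w) = Option.bind (slice_target s c) (\<lambda>c'. target c' w)"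

text \<open>The diagrams with \<open>a\<close> boundary points on the top and \<open>b\<close> on the bottom side.\<close>

definition diagrams :: "nat \<Rightarrow> nat \<Rightarrow> diagram set" where
  "diagrams a b = {w. target a w = Some b}"

section \<open>The Kauffman skein module\<close>

fun position :: "slice \<Rightarrow> nat" where
  "position (Sig i) = i" | "position (SigInv i) = i" | "position (Cap i) = i" | "position (Cup i) = i"

fun set_position :: "nat \<Rightarrow> slice \<Rightarrow> slice" where
  "set_position j (Sig i) = Sig j" | "set_position j (SigInv i) = SigInv j"
| "set_position j (Cap i) = Cap j" | "set_position j (Cup i) = Cup j"

fun strands_in :: "slice \<Rightarrow> nat" where
  "strands_in (Cap i) = 0" | "strands_in _ = 2"

fun strands_out :: "slice \<Rightarrow> nat" where
  "strands_out (Cup i) = 0" | "strands_out _ = 2"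

text \<open>
  Regular isotopy: the first four kinds of moves generate the planar isotopies (exchange of
  heights, cancellation of a maximum with a minimum, a strand crossing a leg of a maximum or of
  a minimum), the others are the Reidemeister moves II and III. The remaining versions of the
  moves II and III follow from the given ones.
\<close>

inductive isotopy_move :: "diagram \<Rightarrow> diagram \<Rightarrow> bool" where
  far: "position s + strands_out s \<le> position t \<Longrightarrow>
    isotopy_move [s, t] [set_position (position t + strands_in s - strands_out s) t, s]"
| zigzag_left: "isotopy_move [Cap (i + 1), Cup i] []"
| zigzag_right: "isotopy_move [Cap i, Cup (i + 1)] []"
| cap_over: "isotopy_move [Cap i, Sig (i + 1)] [Cap (i + 1), SigInv i]"
| cap_under: "isotopy_move [Cap i, SigInv (i + 1)] [Cap (i + 1), Sig i]"
| cup_over: "isotopy_move [Sig i, Cup (i + 1)] [SigInv (i + 1), Cup i]"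
| cup_under: "isotopy_move [SigInv i, Cup (i + 1)] [Sig (i + 1), Cup i]"
| R2_left: "isotopy_move [Sig i, SigInv i] []"
| R2_right: "isotopy_move [SigInv i, Sig i] []"
| R3: "isotopy_move [Sig i, Sig (i + 1), Sig i] [Sig (i + 1), Sig i, Sig (i + 1)]"

text \<open>\<open>\<int>[v, v\<inverse>, z, z\<inverse>]\<close> as the group ring of \<open>\<int> \<times> \<int>\<close>; \<open>mon i j\<close> is \<open>v\<^sup>i z\<^sup>j\<close>.\<close>

type_synonym laurent = "(int \<times> int) \<Rightarrow>\<^sub>0 int"

definition mon :: "int \<Rightarrow> int \<Rightarrow> laurent" where
  "mon i j = Poly_Mapping.single (i, j) 1"

text \<open>
  The local Kauffman relations, as formal combinations of diagrams that are set to zero. In the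
  kink relations the crossing has both strands running in the same vertical direction, whatever
  the orientation of the kinked strand, so that \<open>Sig\<close> is positive. The kinks on the
  legs of maxima and minima are planar isotopic to these.
\<close>

inductive kauffman_relation :: "(laurent \<times> diagram) list \<Rightarrow> bool" where
  crossings: "kauffman_relation
    [(1, [Sig i]), (1, [SigInv i]), (- mon 0 1, []), (- mon 0 1, [Cup i, Cap i])]"
| kink_pos_left: "kauffman_relation [(1, [Cap i, Sig (i + 1), Cup i]), (- mon 1 0, [])]"
| kink_pos_right: "kauffman_relation [(1, [Cap (i + 1), Sig i, Cup (i + 1)]), (- mon 1 0, [])]"
| kink_neg_left: "kauffman_relation [(1, [Cap i, SigInv (i + 1), Cup i]), (- mon (-1) 0, [])]"
| kink_neg_right: "kauffman_relation [(1, [Cap (i + 1), SigInv i, Cup (i + 1)]), (- mon (-1) 0, [])]"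
| trivial_component: "kauffman_relation
    [(1, [Cap i, Cup i]), (- (mon 1 (-1) + mon (-1) (-1) - 1), [])]"

type_synonym combination = "diagram \<Rightarrow>\<^sub>0 laurent"

definition scale :: "laurent \<Rightarrow> combination \<Rightarrow> combination" where
  "scale r x = Poly_Mapping.map ((*) r) x"

lemma lookup_scale: "Poly_Mapping.lookup (scale r x) w = r * Poly_Mapping.lookup x w"
  by (simp add: scale_def Poly_Mapping.map.rep_eq when_def)

lemma module_scale: "module scale"
  by (unfold_locales; rule poly_mapping_eqI; simp add: lookup_scale lookup_add algebra_simps)

definition insert_in :: "diagram \<Rightarrow> diagram \<Rightarrow> (laurent \<times> diagram) list \<Rightarrow> combination" where
  "insert_in pre post r = (\<Sum>(c, w)\<leftarrow>r. Poly_Mapping.single (pre @ w @ post) c)"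

definition skein_relators :: "nat \<Rightarrow> nat \<Rightarrow> combination set" where
  "skein_relators a b = {insert_in pre post r | pre post r.
     ((\<exists>u w. isotopy_move u w \<and> r = [(1, u), (- 1, w)]) \<or> kauffman_relation r) \<and>
     (\<forall>(c, w) \<in> set r. pre @ w @ post \<in> diagrams a b)}"

definition free_module :: "nat \<Rightarrow> nat \<Rightarrow> combination set" where
  "free_module a b = {x. Poly_Mapping.keys x \<subseteq> diagrams a b}"

definition skein_equiv :: "nat \<Rightarrow> nat \<Rightarrow> combination rel" where
  "skein_equiv a b = {(x, y). x \<in> free_module a b \<and> y \<in> free_module a b \<and>
     x - y \<in> module.span scale (skein_relators a b)}"

definition skein_module :: "nat \<Rightarrow> nat \<Rightarrow> combination set set" where
  "skein_module a b = free_module a b // skein_equiv a b"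

definition skein_class :: "nat \<Rightarrow> nat \<Rightarrow> combination \<Rightarrow> combination set" where
  "skein_class a b x = skein_equiv a b `` {x}"

section \<open>String links and their closures\<close>

datatype endpoint = Top nat | Bot nat

text \<open>
  The boundary data of an oriented string link with a closure: the numbers of boundary
  points on the top and on the bottom side, the starting points of the arcs in the order of the
  arcs, the abstract arcs \<open>\<sigma>\<close> (a map from the final points to the starting points), and the
  point \<open>\<infinity>\<close>.
\<close>

record closing =
  tops :: nat
  bots :: nat
  starts :: "endpoint list"
  join :: "endpoint \<Rightarrow> endpoint"
  infpt :: endpoint

definition endpoints :: "closing \<Rightarrow> endpoint set" where
  "endpoints C = Top ` {1..tops C} \<union> Bot ` {1..bots C}"

text \<open>
  The point \<open>(t, i)\<close> is the point on the \<open>i\<close>-th strand just above the slice \<open>w ! t\<close> (on the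
  bottom side, if \<open>t = length w\<close>). A point together with a vertical direction is the state of
  a traveller on the diagram; \<open>go_down s t i\<close> and \<open>go_up s t i\<close> lead the traveller through the
  slice \<open>s = w ! t\<close>, entered at \<open>(t, i)\<close> from above or at \<open>(t + 1, i)\<close> from below.
\<close>

type_synonym point = "nat \<times> nat"

datatype direction = Down | Up

type_synonym state = "point \<times> direction"

fun go_down :: "slice \<Rightarrow> nat \<Rightarrow> nat \<Rightarrow> state" where
  "go_down (Sig j) t i = ((t + 1, transpose j (j + 1) i), Down)"
| "go_down (SigInv j) t i = ((t + 1, transpose j (j + 1) i), Down)"
| "go_down (Cap j) t i = ((t + 1, if i < j then i else i + 2), Down)"
| "go_down (Cup j) t i =
    (if i = j then ((t, j + 1), Up) else if i = j + 1 then ((t, j), Up)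
     else ((t + 1, if i < j then i else i - 2), Down))"

fun go_up :: "slice \<Rightarrow> nat \<Rightarrow> nat \<Rightarrow> state" where
  "go_up (Sig j) t i = ((t, transpose j (j + 1) i), Up)"
| "go_up (SigInv j) t i = ((t, transpose j (j + 1) i), Up)"
| "go_up (Cup j) t i = ((t, if i < j then i else i + 2), Up)"
| "go_up (Cap j) t i =
    (if i = j then ((t + 1, j + 1), Down) else if i = j + 1 then ((t + 1, j), Down)
     else ((t, if i < j then i else i - 2), Up))"

fun advance :: "diagram \<Rightarrow> state \<Rightarrow> state option" where
  "advance w ((t, i), Down) = (if t < length w then Some (go_down (w ! t) t i) else None)"
| "advance w ((t, i), Up) = (if 0 < t then Some (go_up (w ! (t - 1)) (t - 1) i) else None)"

fun inward :: "diagram \<Rightarrow> endpoint \<Rightarrow> state" where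
  "inward w (Top i) = ((0, i), Down)"
| "inward w (Bot i) = ((length w, i), Up)"

fun outward :: "diagram \<Rightarrow> endpoint \<Rightarrow> state" where
  "outward w (Top i) = ((0, i), Up)"
| "outward w (Bot i) = ((length w, i), Down)"

fun exit_point :: "state \<Rightarrow> endpoint" where
  "exit_point ((t, i), Up) = Top i"
| "exit_point ((t, i), Down) = Bot i"

definition points :: "closing \<Rightarrow> diagram \<Rightarrow> point set" where
  "points C w = {(t, i). t \<le> length w \<and> 1 \<le> i \<and> i \<le> the (target (tops C) (take t w))}"

definition string_link :: "nat \<Rightarrow> closing \<Rightarrow> diagram \<Rightarrow> bool" where
  "string_link n C w \<longleftrightarrow>
     w \<in> diagrams (tops C) (bots C) \<and>
     length (starts C) = n \<and> distinct (starts C) \<and> set (starts C) \<subseteq> endpoints C \<and>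
     (\<forall>p \<in> set (starts C). \<exists>q \<in> endpoints C - set (starts C).
        (inward w p, outward w q) \<in> {(x, y). advance w x = Some y}\<^sup>*) \<and>
     (\<forall>x \<in> points C w. \<exists>p \<in> set (starts C). \<exists>d.
        (inward w p, (x, d)) \<in> {(x, y). advance w x = Some y}\<^sup>*)"

text \<open>\<open>visit C w k\<close> is the state after \<open>k\<close> steps along the oriented circle \<open>T \<union> \<sigma>\<close> from \<open>\<infinity>\<close>.\<close>

definition circle_step :: "closing \<Rightarrow> diagram \<Rightarrow> state \<Rightarrow> state" where
  "circle_step C w x =
     (case advance w x of Some y \<Rightarrow> y | None \<Rightarrow> inward w (join C (exit_point x)))"

definition visit :: "closing \<Rightarrow> diagram \<Rightarrow> nat \<Rightarrow> state" where
  "visit C w k = (circle_step C w ^^ k)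
     (if infpt C \<in> set (starts C) then inward w (infpt C) else outward w (infpt C))"

definition closes_to_circle :: "closing \<Rightarrow> diagram \<Rightarrow> bool" where
  "closes_to_circle C w \<longleftrightarrow>
     bij_betw (join C) (endpoints C - set (starts C)) (set (starts C)) \<and>
     infpt C \<in> endpoints C \<and>
     (\<forall>x \<in> points C w. \<exists>k. fst (visit C w k) = x)"

section \<open>Crossings and gradings\<close>

definition met :: "closing \<Rightarrow> diagram \<Rightarrow> point \<Rightarrow> nat" where
  "met C w x = (LEAST k. fst (visit C w k) = x)"

definition met_end :: "closing \<Rightarrow> diagram \<Rightarrow> endpoint \<Rightarrow> nat" where
  "met_end C w p = met C w (fst (inward w p))"

definition runs_down :: "closing \<Rightarrow> diagram \<Rightarrow> point \<Rightarrow> bool" where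
  "runs_down C w x \<longleftrightarrow> (\<exists>k. visit C w k = (x, Down))"

text \<open>A crossing of \<open>w\<close> is given by the index \<open>q\<close> of its slice.\<close>

definition crossing :: "diagram \<Rightarrow> nat \<Rightarrow> bool" where
  "crossing w q \<longleftrightarrow> q < length w \<and> (\<exists>i. w ! q = Sig i \<or> w ! q = SigInv i)"

text \<open>
  The time at which the circle passes through the crossing \<open>q\<close> along the strand with upper point
  \<open>(q, i)\<close>: the moment when it is about to enter the slice, from above or from below.
\<close>

definition passage :: "closing \<Rightarrow> diagram \<Rightarrow> nat \<Rightarrow> nat \<Rightarrow> nat" where
  "passage C w q i =
     (LEAST k. visit C w k = ((q, i), Down) \<or> visit C w k = (fst (go_down (w ! q) q i), Up))"

fun over_position :: "slice \<Rightarrow> nat" where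
  "over_position (Sig i) = i + 1"
| "over_position (SigInv i) = i"
| "over_position _ = 0"

fun under_position :: "slice \<Rightarrow> nat" where
  "under_position (Sig i) = i"
| "under_position (SigInv i) = i + 1"
| "under_position _ = 0"

definition over_time :: "closing \<Rightarrow> diagram \<Rightarrow> nat \<Rightarrow> nat" where
  "over_time C w q = passage C w q (over_position (w ! q))"

definition under_time :: "closing \<Rightarrow> diagram \<Rightarrow> nat \<Rightarrow> nat" where
  "under_time C w q = passage C w q (under_position (w ! q))"

definition type1 :: "closing \<Rightarrow> diagram \<Rightarrow> nat \<Rightarrow> bool" where
  "type1 C w q \<longleftrightarrow> under_time C w q < over_time C w q"

fun parallel_sign :: "slice \<Rightarrow> int" where
  "parallel_sign (Sig i) = 1"
| "parallel_sign (SigInv i) = - 1"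
| "parallel_sign _ = 0"

definition writhe :: "closing \<Rightarrow> diagram \<Rightarrow> nat \<Rightarrow> int" where
  "writhe C w q = parallel_sign (w ! q) *
     (if runs_down C w (q, position (w ! q)) = runs_down C w (q, position (w ! q) + 1)
      then 1 else - 1)"

text \<open>
  \<open>D\<^sub>q\<^sup>+ \<inter> \<partial>T\<close> for a crossing \<open>q\<close> of type 1: the arc from the over-cross to the under-cross
  runs through \<open>\<infinity>\<close>, where the time starts.
\<close>

definition crossing_grading :: "closing \<Rightarrow> diagram \<Rightarrow> nat \<Rightarrow> endpoint set" where
  "crossing_grading C w q =
     {p \<in> endpoints C. over_time C w q < met_end C w p \<or> met_end C w p \<le> under_time C w q}"

text \<open>
  The cyclic order of a grading is the one in which the circle meets its points. The sign of a
  boundary point says whether the string link starts or ends there.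
\<close>

definition grading :: "closing \<Rightarrow> diagram \<Rightarrow> endpoint set \<Rightarrow> bool" where
  "grading C w A \<longleftrightarrow> A \<subseteq> endpoints C \<and> infpt C \<in> A \<and>
     (\<exists>ps. set ps = A \<and> sorted_wrt (\<lambda>p q. met_end C w p < met_end C w q) ps \<and>
       (\<forall>i < length ps. (ps ! i \<in> set (starts C)) \<noteq>
          (ps ! ((i + 1) mod length ps) \<in> set (starts C))))"

section \<open>Positive triple crossings\<close>

text \<open>
  A positive triple crossing in a diagram, with its three branches running downwards in the
  positions \<open>offset + 1\<close>, \<open>offset + 2\<close>, \<open>offset + 3\<close> between the part \<open>above\<close> and the
  part \<open>below\<close>. A positive 3-braid is a list over \<open>{1, 2}\<close>; \<open>plug p \<beta>\<close> is the diagram \<open>\<beta>(p)\<close>.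
\<close>

record triple_crossing =
  above :: diagram
  offset :: nat
  below :: diagram

definition braid_at :: "nat \<Rightarrow> nat list \<Rightarrow> diagram" where
  "braid_at k \<beta> = map (\<lambda>i. Sig (k + i)) \<beta>"

definition plug :: "triple_crossing \<Rightarrow> nat list \<Rightarrow> diagram" where
  "plug p \<beta> = above p @ braid_at (offset p) \<beta> @ below p"

text \<open>
  Crossings near \<open>p\<close> are read off from the perturbation \<open>\<sigma>\<^sub>1\<sigma>\<^sub>2\<sigma>\<^sub>1\<close>; the data used below
  are the same for \<open>\<sigma>\<^sub>2\<sigma>\<^sub>1\<sigma>\<^sub>2\<close>. The branch that enters on the left leaves on the right, below
  the two others, and the one that enters on the right is the highest. So the
  first crossing of \<open>\<sigma>\<^sub>1\<sigma>\<^sub>2\<sigma>\<^sub>1\<close> is \<open>ml\<close>, the second \<open>d\<close> and the third \<open>hm\<close>.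
\<close>

definition perturbed :: "triple_crossing \<Rightarrow> diagram" where
  "perturbed p = plug p [1, 2, 1]"

definition crossing_d :: "triple_crossing \<Rightarrow> nat" where
  "crossing_d p = length (above p) + 1"

definition crossing_hm :: "triple_crossing \<Rightarrow> nat" where
  "crossing_hm p = length (above p) + 2"

definition met_low :: "closing \<Rightarrow> triple_crossing \<Rightarrow> nat" where
  "met_low C p = met C (perturbed p) (length (above p), offset p + 1)"

definition met_mid :: "closing \<Rightarrow> triple_crossing \<Rightarrow> nat" where
  "met_mid C p = met C (perturbed p) (length (above p), offset p + 2)"

definition met_high :: "closing \<Rightarrow> triple_crossing \<Rightarrow> nat" where
  "met_high C p = met C (perturbed p) (length (above p), offset p + 3)"

definition type_ra :: "closing \<Rightarrow> triple_crossing \<Rightarrow> bool" where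
  "type_ra C p \<longleftrightarrow> met_mid C p < met_high C p \<and> met_high C p < met_low C p"

definition type_lc :: "closing \<Rightarrow> triple_crossing \<Rightarrow> bool" where
  "type_lc C p \<longleftrightarrow> met_mid C p < met_low C p \<and> met_low C p < met_high C p"

definition d_type0 :: "closing \<Rightarrow> triple_crossing \<Rightarrow> bool" where
  "d_type0 C p \<longleftrightarrow> \<not> type1 C (perturbed p) (crossing_d p)"

definition hm_grading :: "closing \<Rightarrow> triple_crossing \<Rightarrow> endpoint set" where
  "hm_grading C p = crossing_grading C (perturbed p) (crossing_hm p)"

definition f_crossings :: "closing \<Rightarrow> triple_crossing \<Rightarrow> nat set" where
  "f_crossings C p = {q. crossing (perturbed p) q \<and> q \<noteq> crossing_d p \<and>
     type1 C (perturbed p) q \<and>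
     under_time C (perturbed p) q < over_time C (perturbed p) (crossing_d p)}"

definition W :: "closing \<Rightarrow> endpoint set \<Rightarrow> triple_crossing \<Rightarrow> int" where
  "W C A p = (\<Sum>q \<in> {q \<in> f_crossings C p. crossing_grading C (perturbed p) q = A}.
     writhe C (perturbed p) q)"

section \<open>The meridian of a positive quadruple crossing and the cochain\<close>

text \<open>
  The quadruple crossing lies between the parts \<open>L\<close> (above) and \<open>U\<close> (below), in the positions
  \<open>k + 1\<close> to \<open>k + 4\<close>. One of its perturbations is the half twist 121321; the branch entering in
  the position \<open>k + j\<close> is the \<open>j\<close>-th lowest. Since all letters are \<open>Sig\<close>, its six crossings are
  positive as soon as the four branches run in the same direction, here downwards.
\<close>

definition half_twist :: "diagram \<Rightarrow> nat \<Rightarrow> diagram \<Rightarrow> diagram" where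
  "half_twist L k U = L @ braid_at k [1, 2, 1, 3, 2, 1] @ U"

definition positive_quadruple_crossing :: "closing \<Rightarrow> diagram \<Rightarrow> nat \<Rightarrow> diagram \<Rightarrow> bool" where
  "positive_quadruple_crossing C L k U \<longleftrightarrow>
     (\<forall>j \<in> {1, 2, 3, 4}. runs_down C (half_twist L k U) (length L, k + j))"

text \<open>
  \<open>move L k U s u i w\<close> is the positive Reidemeister III move of sign \<open>s\<close> at the generators
  \<open>i, i+1\<close> inside the 4-braid, performed after the letters \<open>u\<close> and before the letters \<open>w\<close>.
\<close>

definition move ::
  "diagram \<Rightarrow> nat \<Rightarrow> diagram \<Rightarrow> int \<Rightarrow> nat list \<Rightarrow> nat \<Rightarrow> nat list \<Rightarrow> int \<times> triple_crossing" where
  "move L k U s u i w =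
     (s, \<lparr>above = L @ braid_at k u, offset = k + i - 1, below = braid_at k w @ U\<rparr>)"

definition meridian :: "diagram \<Rightarrow> nat \<Rightarrow> diagram \<Rightarrow> (int \<times> triple_crossing) list" where
  "meridian L k U =
     [move L k U 1 [] 1 [3, 2, 1],      \<comment> \<open>\<open>[121 \<rightarrow> 212]321\<close>\<close>
      move L k U 1 [2, 1] 2 [1],        \<comment> \<open>\<open>21[232 \<rightarrow> 323]1\<close>\<close>
      move L k U 1 [2, 3] 1 [3],        \<comment> \<open>\<open>23[121 \<rightarrow> 212]3\<close>\<close>
      move L k U 1 [] 2 [1, 2, 3],      \<comment> \<open>\<open>[232 \<rightarrow> 323]123\<close>\<close>
      move L k U (- 1) [3, 2, 1] 2 [],  \<comment> \<open>\<open>321[323 \<rightarrow> 232]\<close>\<close>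
      move L k U (- 1) [3] 1 [3, 2],    \<comment> \<open>\<open>3[212 \<rightarrow> 121]32\<close>\<close>
      move L k U (- 1) [1] 2 [1, 2],    \<comment> \<open>\<open>1[323 \<rightarrow> 232]12\<close>\<close>
      move L k U (- 1) [1, 2, 3] 1 []]  \<comment> \<open>\<open>123[212 \<rightarrow> 121]\<close>\<close>"

definition resolved :: "triple_crossing \<Rightarrow> nat list \<Rightarrow> combination" where
  "resolved p \<beta> = Poly_Mapping.single (plug p \<beta>) 1"

definition R_F_reg ::
  "closing \<Rightarrow> (int \<times> triple_crossing) list \<Rightarrow> endpoint set \<Rightarrow> combination set" where
  "R_F_reg C m A = skein_class (tops C) (bots C)
     ((\<Sum>(s, p)\<leftarrow>filter (\<lambda>(s, p). (type_lc C p \<or> type_ra C p) \<and> hm_grading C p = A) m.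
         scale (of_int s) (resolved p [2, 1])) +
      (\<Sum>(s, p)\<leftarrow>filter (\<lambda>(s, p). d_type0 C p) m.
         scale (of_int (s * W C A p)) (resolved p [2, 2] - resolved p [1, 1])))"

end

theory Submission
  imports Defs
begin

text \<open>
  Every diagram of the meridian is a half twist on six letters between the same surroundings
  \<open>L\<close> and \<open>U\<close>. Hence the circle is, outside the six slices of the half twist, in the same place
  at the same time for all of them, and a crossing of the branches \<open>a < b\<close> has type, grading and
  relative order depending only on the times \<open>E a\<close> and \<open>E b\<close> of entry. So the two triple
  crossings with the same branches \<open>low < mid < high\<close> contribute to both sums under the same
  conditions, and their \<open>W\<close> agree, except for a crossing of \<open>high\<close> with a still higher branch: it
  lies before \<open>d\<close> in one of them and after \<open>d\<close> in the other. This happens only for the branches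
  1, 2, 3 with the crossing of 3 and 4.

  In the first sum the contributions of the branches 134 do not cancel. They appear when
  \<open>E 3 < E 1\<close>, \<open>E 3 < E 4\<close> and the crossing of 3 and 4 has grading \<open>A\<close>, which is
  exactly when the values of \<open>W\<close> for the branches 123 differ; the two defects are opposite. In the
  second sum the remaining terms of 123 and of 234 cancel by Reidemeister moves, and those of 124
  cancel against those of 134, which share the crossing \<open>d\<close> of 1 and 4.
\<close>

section \<open>Travelling along a closed string link\<close>

fun turn :: "state \<Rightarrow> state" where
  "turn (x, Down) = (x, Up)"
| "turn (x, Up) = (x, Down)"

lemma turn_turn [simp]: "turn (turn x) = x"
  by (cases x rule: turn.cases) auto

lemma turn_neq [simp]: "turn x \<noteq> x" "x \<noteq> turn x"
  by (cases x rule: turn.cases; simp)+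

lemma fst_turn [simp]: "fst (turn x) = fst x"
  by (cases x rule: turn.cases) auto

lemma turn_inward [simp]: "turn (inward w p) = outward w p"
  by (cases p) auto

lemma turn_outward [simp]: "turn (outward w p) = inward w p"
  by (cases p) auto

lemma outward_inject:
  assumes "outward w p = outward w q" shows "p = q"
  using assms by (cases p; cases q) auto

lemma exit_point_outward [simp]: "exit_point (outward w p) = p"
  by (cases p) auto

lemma advance_outward [simp]: "advance w (outward w p) = None"
  by (cases p) auto

text \<open>Slices can be traversed backwards: crossings act by an involution, and maxima and minima
  swap their two legs. The bound on the level rules out upward states below the diagram, whose
  reversal could not go on.\<close>

lemma advance_turn:
  assumes "advance w x = Some y" "fst (fst x) \<le> length w"
  shows "advance w (turn y) = Some (turn x)"
proof -
  obtain t i d where x: "x = ((t, i), d)" by (cases x) auto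
  show ?thesis
  proof (cases d)
    case Down
    with assms x show ?thesis by (cases "w ! t") (auto split: if_splits)
  next
    case Up
    with assms x show ?thesis by (cases "w ! (t - 1)") (auto split: if_splits)
  qed
qed

lemma advance_le_length:
  assumes "advance w x = Some y" "fst (fst x) \<le> length w"
  shows "fst (fst y) \<le> length w"
proof -
  obtain t i d where x: "x = ((t, i), d)" by (cases x) auto
  show ?thesis
  proof (cases d)
    case Down
    with assms x show ?thesis by (cases "w ! t") (auto split: if_splits)
  next
    case Up
    with assms x show ?thesis by (cases "w ! (t - 1)") (auto split: if_splits)
  qed
qed

lemma advance_moves:
  assumes "advance w x = Some y"
  shows "fst y \<noteq> fst x"
proof -
  obtain t i d where x: "x = ((t, i), d)" by (cases x) auto
  show ?thesis
  proof (cases d)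
    case Down
    with assms x show ?thesis by (cases "w ! t") (auto split: if_splits)
  next
    case Up
    with assms x show ?thesis by (cases "w ! (t - 1)") (auto split: if_splits)
  qed
qed

lemma visit_0:
  "visit C w 0 = (if infpt C \<in> set (starts C) then inward w (infpt C) else outward w (infpt C))"
  by (simp add: visit_def)

lemma visit_Suc: "visit C w (Suc m) = circle_step C w (visit C w m)"
  by (simp add: visit_def)

lemma fst_inward_le: "fst (fst (inward w p)) \<le> length w"
  by (cases p) auto

lemma fst_outward_le: "fst (fst (outward w p)) \<le> length w"
  by (cases p) auto

lemma visit_le_length: "fst (fst (visit C w m)) \<le> length w"
proof (induction m)
  case 0
  show ?case by (simp add: visit_0 fst_inward_le fst_outward_le)
next
  case (Suc m)
  then show ?case
    using advance_le_length[of w "visit C w m"]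
    by (auto simp: visit_Suc circle_step_def fst_inward_le split: option.splits)
qed

lemma target_append: "target c (u @ w) = Option.bind (target c u) (\<lambda>c'. target c' w)"
  by (induction u arbitrary: c) (auto split: bind_split)

text \<open>A downward state at level \<open>Suc q\<close> comes from slice \<open>q\<close> taken
  downwards or from a turn at a maximum in that slice, while re-entry through \<open>join\<close>
  heads down only at level 0. At a crossing just the first case remains, so the step can be
  undone.\<close>

lemma circle_step_down_from_crossing:
  assumes "q < length w" "w ! q = Sig j \<or> w ! q = SigInv j"
    and "circle_step C w x = ((Suc q, i), Down)"
  shows "x = ((q, transpose j (j + 1) i), Down)"
proof -
  obtain t l d where x: "x = ((t, l), d)" by (cases x) auto
  show ?thesis
  proof (cases "advance w x")
    case None
    with assms(3) show ?thesis by (cases "join C (exit_point x)") (auto simp: circle_step_def)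
  next
    case (Some y)
    then have y: "y = ((Suc q, i), Down)" using assms(3) by (simp add: circle_step_def)
    show ?thesis
    proof (cases d)
      case Down
      with x Some y assms(2) show ?thesis by (cases "w ! t") (auto split: if_splits)
    next
      case Up
      with x Some y assms(2) show ?thesis by (cases "w ! (t - 1)") (auto split: if_splits)
    qed
  qed
qed

lemma circle_step_up_from_crossing:
  assumes "q < length w" "w ! q = Sig j \<or> w ! q = SigInv j"
    and "circle_step C w x = ((q, i), Up)"
  shows "x = ((Suc q, transpose j (j + 1) i), Up)"
proof -
  obtain t l d where x: "x = ((t, l), d)" by (cases x) auto
  show ?thesis
  proof (cases "advance w x")
    case None
    with assms show ?thesis by (cases "join C (exit_point x)") (auto simp: circle_step_def)
  next
    case (Some y)
    then have y: "y = ((q, i), Up)" using assms(3) by (simp add: circle_step_def)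
    show ?thesis
    proof (cases d)
      case Down
      with x Some y assms(2) show ?thesis by (cases "w ! t") (auto split: if_splits)
    next
      case Up
      with x Some y assms(2) show ?thesis by (cases "w ! (t - 1)") (auto split: if_splits)
    qed
  qed
qed

section \<open>The oriented circle: one direction at each point, both strands at each
  crossing\<close>

locale closed_string_link =
  fixes n :: nat and C :: closing and w :: diagram
  assumes string_link: "string_link n C w"
    and closes: "closes_to_circle C w"
begin

definition step_rel :: "state rel" where
  "step_rel = {(x, y). advance w x = Some y}"

lemma step_rel_iff: "(x, y) \<in> step_rel \<longleftrightarrow> advance w x = Some y"
  by (simp add: step_rel_def)

lemma join_start: "q \<in> endpoints C - set (starts C) \<Longrightarrow> join C q \<in> set (starts C)"
  using closes unfolding closes_to_circle_def bij_betw_def by blast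

lemma arc_end:
  assumes "p \<in> set (starts C)"
  obtains q where "q \<in> endpoints C - set (starts C)" "(inward w p, outward w q) \<in> step_rel\<^sup>*"
  using assms string_link unfolding string_link_def step_rel_def by blast

text \<open>\<open>advance\<close> is deterministic, so of two runs from the same state one
  continues the other, and a run that has stopped is the longer one.\<close>

lemma arc_continues:
  assumes "(x, y) \<in> step_rel\<^sup>*" "(x, z) \<in> step_rel\<^sup>*" "advance w z = None"
  shows "(y, z) \<in> step_rel\<^sup>*"
  using assms
proof (induction rule: rtrancl_induct)
  case (step u v)
  then have "(u, z) \<in> step_rel\<^sup>*" "u \<noteq> z" by (auto simp: step_rel_iff)
  then obtain v' where "(u, v') \<in> step_rel" "(v', z) \<in> step_rel\<^sup>*"
    by (meson converse_rtranclE)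
  with step.hyps show ?case by (simp add: step_rel_iff)
qed

lemma arc_stops:
  assumes "p \<in> set (starts C)" "(inward w p, x) \<in> step_rel\<^sup>*" "advance w x = None"
  obtains q where "q \<in> endpoints C - set (starts C)" "x = outward w q"
proof -
  obtain q where q: "q \<in> endpoints C - set (starts C)" "(inward w p, outward w q) \<in> step_rel\<^sup>*"
    using arc_end assms(1) by blast
  have "(x, outward w q) \<in> step_rel\<^sup>*"
    by (rule arc_continues[OF assms(2) q(2)]) simp
  then have "x = outward w q"
  proof (rule converse_rtranclE)
    fix y assume "(x, y) \<in> step_rel"
    with assms(3) show ?thesis by (simp add: step_rel_iff)
  qed
  with q(1) that show ?thesis by blast
qed

text \<open>The second alternative covers the beginning, when \<open>infpt C\<close> is a final
  point and no start has been passed yet. Later the circle stops only at final points, by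
  \<open>arc_stops\<close>, and \<open>join\<close> leads from there to a start.\<close>

lemma visit_arc:
  "(\<exists>p \<in> set (starts C). (inward w p, visit C w m) \<in> step_rel\<^sup>*) \<or>
   (\<exists>q \<in> endpoints C - set (starts C). visit C w m = outward w q)" (is "?arc m \<or> ?end m")
proof (induction m)
  case 0
  show ?case
  proof (cases "infpt C \<in> set (starts C)")
    case True
    then have "(inward w (infpt C), visit C w 0) \<in> step_rel\<^sup>*" by (simp add: visit_0)
    with True show ?thesis by blast
  next
    case False
    then have "visit C w 0 = outward w (infpt C)" by (simp add: visit_0)
    moreover have "infpt C \<in> endpoints C" using closes unfolding closes_to_circle_def by blast
    ultimately show ?thesis using False by blast
  qed
next
  case (Suc m)
  show ?case
  proof (cases "advance w (visit C w m)")
    case None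
    have "?end m"
      using Suc.IH
    proof
      assume "?arc m"
      then obtain p where "p \<in> set (starts C)" "(inward w p, visit C w m) \<in> step_rel\<^sup>*" by blast
      from this None obtain q where "q \<in> endpoints C - set (starts C)" "visit C w m = outward w q"
        by (rule arc_stops)
      then show ?thesis by blast
    qed
    then obtain q where q: "q \<in> endpoints C - set (starts C)" "visit C w m = outward w q" by blast
    then have "visit C w (Suc m) = inward w (join C q)" 
      by (simp add: visit_Suc circle_step_def)
    then have "(inward w (join C q), visit C w (Suc m)) \<in> step_rel\<^sup>*" by simp
    with join_start[OF q(1)] show ?thesis by blast
  next
    case (Some y)
    then have "visit C w m \<noteq> outward w q" for q by auto
    with Suc.IH have "?arc m" by blast
    then obtain p where p: "p \<in> set (starts C)" "(inward w p, visit C w m) \<in> step_rel\<^sup>*"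
      by blast
    have "(visit C w m, visit C w (Suc m)) \<in> step_rel"
      using Some by (simp add: visit_Suc circle_step_def step_rel_iff)
    with p show ?thesis by (meson rtrancl.rtrancl_into_rtrancl)
  qed
qed

lemma visit_end:
  assumes "advance w (visit C w m) = None"
  obtains q where "q \<in> endpoints C - set (starts C)" "visit C w m = outward w q"
  using visit_arc[of m]
proof
  assume "\<exists>p \<in> set (starts C). (inward w p, visit C w m) \<in> step_rel\<^sup>*"
  then obtain p where p: "p \<in> set (starts C)" "(inward w p, visit C w m) \<in> step_rel\<^sup>*" by blast
  show thesis by (rule arc_stops[OF p assms]) (rule that)
next
  assume "\<exists>q \<in> endpoints C - set (starts C). visit C w m = outward w q"
  then show thesis using that by blast
qed

text \<open>Outward states have no successor, and the circle stops only at final points. This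
  excludes turning around at the boundary.\<close>

lemma visit_neq_outward_start:
  assumes "p \<in> set (starts C)"
  shows "visit C w m \<noteq> outward w p"
proof
  assume p: "visit C w m = outward w p"
  then have "advance w (visit C w m) = None" by simp
  then obtain q where q: "q \<in> endpoints C - set (starts C)" "visit C w m = outward w q"
    by (rule visit_end)
  with p have "p = q" using outward_inject[of w p q] by simp
  with assms q(1) show False by simp
qed

lemma visit_Suc_cases:
  obtains (advance) "advance w (visit C w m) = Some (visit C w (Suc m))"
  | (join) p where "p \<in> set (starts C)" "visit C w (Suc m) = inward w p"
proof (cases "advance w (visit C w m)")
  case None
  then obtain q where "q \<in> endpoints C - set (starts C)" "visit C w m = outward w q"
    by (rule visit_end)
  then show ?thesis
    using join_start[of q] join[of "join C q"] by (simp add: visit_Suc circle_step_def)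
next
  case (Some y)
  with advance show ?thesis by (simp add: visit_Suc circle_step_def)
qed

text \<open>
  Otherwise the two passages could be followed towards each other until they meet, at a point
  where the circle would have to turn around.
\<close>

lemma visit_neq_turn_later: "visit C w m \<noteq> turn (visit C w (m + d))"
proof (induction d arbitrary: m rule: less_induct)
  case (less d)
  show ?case
  proof
    assume meet: "visit C w m = turn (visit C w (m + d))"
    show False
    proof (cases d)
      case 0
      with meet show False by simp
    next
      case (Suc d')
      then have later: "visit C w (m + d) = visit C w (Suc (m + d'))" by simp
      show False
      proof (cases rule: visit_Suc_cases[of "m + d'"])
        case advance
        have "advance w (visit C w m) = Some (turn (visit C w (m + d')))"
          using advance_turn[OF advance visit_le_length] meet later by simp
        then have next_m: "visit C w (Suc m) = turn (visit C w (m + d'))"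
          by (simp add: visit_Suc circle_step_def)
        \<comment> \<open>The gap shrinks by two. If it was 1, a single step would end at the point
          where it began, contrary to \<open>advance_moves\<close>.\<close>
        show False
        proof (cases d')
          case 0
          with advance advance_moves meet Suc show False by fastforce
        next
          case (Suc d'')
          with next_m less.IH[of d'' "Suc m"] \<open>d = Suc d'\<close> show False by simp
        qed
      next
        case (join p)
        with meet later show False using visit_neq_outward_start by simp
      qed
    qed
  qed
qed

lemma visit_one_direction: "visit C w l \<noteq> turn (visit C w m)"
proof (cases "l \<le> m")
  case True
  then show ?thesis using visit_neq_turn_later[of l "m - l"] by simp
next
  case False
  then show ?thesis using visit_neq_turn_later[of m "l - m"] by (metis le_add_diff_inverse nat_le_linear turn_turn)
qed

lemma point_visited:
  assumes "x \<in> points C w" obtains m where "fst (visit C w m) = x"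
  using closes assms unfolding closes_to_circle_def by blast

lemma endpoint_visited:
  assumes "p \<in> endpoints C" obtains m where "fst (visit C w m) = fst (inward w p)"
proof -
  have "target (tops C) w = Some (bots C)"
    using string_link unfolding string_link_def diagrams_def by blast
  then have "fst (inward w p) \<in> points C w"
    using assms by (auto simp: endpoints_def points_def)
  then show ?thesis using point_visited that by blast
qed

lemma crossing_points:
  assumes "q < length w" "w ! q = Sig j \<or> w ! q = SigInv j" "i \<in> {j, j + 1}"
  shows "(q, i) \<in> points C w" "(Suc q, i) \<in> points C w"
proof -
  have "target (tops C) w = Some (bots C)"
    using string_link unfolding string_link_def diagrams_def by blast
  then have "target (tops C) (take q w @ w ! q # drop (Suc q) w) = Some (bots C)"
    using assms(1) by (simp add: id_take_nth_drop[symmetric])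
  then obtain c where c: "target (tops C) (take q w) = Some c" "slice_target (w ! q) c \<noteq> None"
    by (auto simp: target_append bind_eq_Some_conv)
  then have bounds: "1 \<le> j" "j + 1 \<le> c" and c': "slice_target (w ! q) c = Some c"
    using assms(2) by (auto split: if_splits)
  have "target (tops C) (take (Suc q) w) = Some c"
    using assms(1) c(1) c' by (simp add: take_Suc_conv_app_nth target_append)
  with c(1) bounds assms(1,3) show "(q, i) \<in> points C w" "(Suc q, i) \<in> points C w"
    by (auto simp: points_def)
qed

text \<open>Ensures that the minimum in \<open>passage\<close> is attained. From
  \<open>closes_to_circle\<close> one only has visits of the two ends of the strand, in unknown
  directions.\<close>

lemma crossing_visited:
  assumes "q < length w" "w ! q = Sig j \<or> w ! q = SigInv j" "i \<in> {j, j + 1}"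
  obtains m where "visit C w m = ((q, i), Down) \<or>
    visit C w m = ((Suc q, transpose j (j + 1) i), Up)"
proof -
  define i' where "i' = transpose j (j + 1) i"
  have i': "i' \<in> {j, j + 1}" "transpose j (j + 1) i' = i"
    using assms(3) by (auto simp: i'_def)
  obtain m1 d1 where m1: "visit C w m1 = ((q, i), d1)"
    using point_visited[OF crossing_points(1)[OF assms]] by (metis prod.collapse)
  obtain m2 d2 where m2: "visit C w m2 = ((Suc q, i'), d2)"
    using point_visited[OF crossing_points(2)[OF assms(1,2) i'(1)]] by (metis prod.collapse)
  show ?thesis
  proof (cases "d1 = Down \<or> d2 = Up")
    case True
    with m1 m2 that show ?thesis by (auto simp: i'_def)
  next
    case False
    then have d: "d1 = Up" "d2 = Down" using direction.exhaust by blast+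
    \<comment> \<open>Now both visits lead away from the crossing. They are not both at time 0, and
      one step before a visit at a positive time the circle was about to enter the crossing.\<close>
    from m1 m2 have "m1 \<noteq> m2" by auto
    then consider l where "m1 = Suc l" | l where "m2 = Suc l" by (metis not0_implies_Suc)
    then show ?thesis
    proof cases
      case 1
      with m1 d have "circle_step C w (visit C w l) = ((q, i), Up)" by (simp add: visit_Suc)
      then have "visit C w l = ((Suc q, transpose j (j + 1) i), Up)"
        by (rule circle_step_up_from_crossing[OF assms(1,2)])
      with that show ?thesis by blast
    next
      case 2
      with m2 d have "circle_step C w (visit C w l) = ((Suc q, i'), Down)" by (simp add: visit_Suc)
      then have "visit C w l = ((q, transpose j (j + 1) i'), Down)"
        by (rule circle_step_down_from_crossing[OF assms(1,2)])
      with i' that show ?thesis by auto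
    qed
  qed
qed

end

section \<open>Half twists between fixed surroundings\<close>

fun track :: "nat list \<Rightarrow> nat \<Rightarrow> nat" where
  "track [] j = j"
| "track (i # \<beta>) j = track \<beta> (transpose i (i + 1) j)"

lemma track_append: "track (\<beta> @ \<gamma>) j = track \<gamma> (track \<beta> j)"
  by (induction \<beta> arbitrary: j) auto

lemma track_track_rev: "track \<beta> (track (rev \<beta>) j) = j"
  by (induction \<beta> arbitrary: j) (auto simp: track_append)

lemma track_rev_track: "track (rev \<beta>) (track \<beta> j) = j"
  using track_track_rev[of "rev \<beta>" j] by simp

lemma track_bounds:
  assumes "set \<beta> \<subseteq> {1, 2, 3}" "j \<in> {1..4}"
  shows "track \<beta> j \<in> {1..4}"
  using assms by (induction \<beta> arbitrary: j) (auto simp: transpose_def)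

lemma track_take_Suc:
  assumes "s < length \<beta>"
  shows "track (take (Suc s) \<beta>) j = transpose (\<beta> ! s) (\<beta> ! s + 1) (track (take s \<beta>) j)"
  using assms by (simp add: take_Suc_conv_app_nth track_append)

lemma transpose_add: "transpose (k + i) (k + i + 1) (k + j) = k + transpose i (i + 1) (j :: nat)"
  by (auto simp: transpose_def)

text \<open>Equal lengths keep the traversals of all perturbations in step, and equal permutations
  make each branch leave at the same place.\<close>

definition half_twist_word :: "nat list \<Rightarrow> bool" where
  "half_twist_word \<beta> \<longleftrightarrow>
     length \<beta> = 6 \<and> set \<beta> \<subseteq> {1, 2, 3} \<and> (\<forall>j \<in> {1..4}. track \<beta> j = 5 - j)"

text \<open>The perturbation in \<open>half_twist\<close>, for which the hypotheses on the string
  link are stated; all others are compared with it.\<close>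

definition standard_word :: "nat list" where
  "standard_word = [1, 2, 1, 3, 2, 1]"

lemma half_twist_word_standard: "half_twist_word standard_word"
  by (auto simp: half_twist_word_def standard_word_def transpose_def)

lemma length_braid_at [simp]: "length (braid_at k \<beta>) = length \<beta>"
  by (simp add: braid_at_def)

lemma braid_at_append: "braid_at k (\<beta> @ \<gamma>) = braid_at k \<beta> @ braid_at k \<gamma>"
  by (simp add: braid_at_def)

locale quadruple_crossing = closed_string_link n C "half_twist L k U"
  for n :: nat and C :: closing and L :: diagram and k :: nat and U :: diagram +
  assumes positive: "positive_quadruple_crossing C L k U"
begin

definition completed :: "nat list \<Rightarrow> diagram" where
  "completed \<beta> = L @ braid_at k \<beta> @ U"

definition entry :: "nat \<Rightarrow> state" where
  "entry j = ((length L, k + j), Down)"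

definition on_branch :: "nat list \<Rightarrow> nat \<Rightarrow> nat \<Rightarrow> state" where
  "on_branch \<beta> s j = ((length L + s, k + track (take s \<beta>) j), Down)"

text \<open>The first and the last level are left out, since there the circle still has the same
  states in all perturbations.\<close>

definition interior :: "point \<Rightarrow> bool" where
  "interior x \<longleftrightarrow> fst x \<in> {length L<..<length L + 6} \<and> snd x \<in> {k + 1..k + 4}"

abbreviation standard :: diagram where
  "standard \<equiv> completed standard_word"

lemma half_twist_completed: "half_twist L k U = standard"
  by (simp add: half_twist_def completed_def standard_word_def)

lemma length_completed:
  assumes "half_twist_word \<beta>" shows "length (completed \<beta>) = length L + 6 + length U"
  using assms by (simp add: completed_def half_twist_word_def)

lemma nth_completed:
  assumes "half_twist_word \<beta>"
  shows "completed \<beta> ! t = (if t < length L then L ! t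
    else if t < length L + 6 then Sig (k + \<beta> ! (t - length L)) else U ! (t - length L - 6))"
  using assms by (auto simp: completed_def half_twist_word_def nth_append braid_at_def)

lemma letter_bounds:
  assumes "half_twist_word \<beta>" "s < 6" shows "\<beta> ! s \<in> {1..3}"
proof -
  have "\<beta> ! s \<in> {1, 2, 3}"
    using assms nth_mem[of s \<beta>] unfolding half_twist_word_def by (metis subsetD)
  then show ?thesis by auto
qed

lemma track_take_bounds:
  assumes "half_twist_word \<beta>" "j \<in> {1..4}"
  shows "track (take s \<beta>) j \<in> {1..4}"
proof (rule track_bounds)
  show "set (take s \<beta>) \<subseteq> {1, 2, 3}"
    using assms(1) set_take_subset[of s \<beta>] unfolding half_twist_word_def by blast
qed (fact assms(2))

lemma on_branch_0: "on_branch \<beta> 0 j = entry j"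
  by (simp add: on_branch_def entry_def)

lemma on_branch_6:
  assumes "half_twist_word \<beta>" "j \<in> {1..4}"
  shows "on_branch \<beta> 6 j = ((length L + 6, k + (5 - j)), Down)"
  using assms by (simp add: on_branch_def half_twist_word_def)

lemma circle_step_on_branch:
  assumes "half_twist_word \<beta>" "s < 6"
  shows "circle_step C (completed \<beta>) (on_branch \<beta> s j) = on_branch \<beta> (Suc s) j"
proof -
  have "s < length \<beta>" using assms by (simp add: half_twist_word_def)
  then show ?thesis
    using assms track_take_Suc[of s \<beta> j] transpose_add[of k "\<beta> ! s" "track (take s \<beta>) j"]
    by (simp add: circle_step_def on_branch_def length_completed nth_completed)
qed

lemma follow_branch:
  assumes "half_twist_word \<beta>" "visit C (completed \<beta>) m = entry j" "s \<le> 6"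
  shows "visit C (completed \<beta>) (m + s) = on_branch \<beta> s j"
  using assms(3)
proof (induction s)
  case 0
  then show ?case using assms(2) by (simp add: on_branch_0)
next
  case (Suc s)
  then show ?case
    using circle_step_on_branch[OF assms(1), of s j] by (simp add: visit_Suc)
qed

lemma branch_entered:
  assumes "j \<in> {1..4}" obtains m where "visit C standard m = entry j"
proof -
  have "j \<in> {1, 2, 3, 4}" using assms by auto
  then have "runs_down C (half_twist L k U) (length L, k + j)"
    using positive unfolding positive_quadruple_crossing_def by blast
  with that show ?thesis by (auto simp: runs_down_def entry_def half_twist_completed)
qed

text \<open>The four downward branches occupy all four positions at both levels, position
  \<open>i\<close> at the lower one being the exit of branch \<open>5 - i\<close>. So
  \<open>visit_one_direction\<close> applies.\<close>

lemma not_upwards: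
  assumes "i \<in> {1..4}"
  shows "visit C standard m \<noteq> ((length L, k + i), Up)"
    and "visit C standard m \<noteq> ((length L + 6, k + i), Up)"
proof -
  obtain l where l: "visit C standard l = entry i" using branch_entered assms .
  show "visit C standard m \<noteq> ((length L, k + i), Up)"
    using visit_one_direction[of m l] l by (simp add: half_twist_completed entry_def)
  have "5 - i \<in> {1..4}" using assms by auto
  then obtain l' where "visit C standard l' = entry (5 - i)" by (rule branch_entered)
  then have "visit C standard (l' + 6) = on_branch standard_word 6 (5 - i)"
    by (intro follow_branch half_twist_word_standard) simp_all
  then have "visit C standard (l' + 6) = ((length L + 6, k + i), Down)"
    using on_branch_6[OF half_twist_word_standard \<open>5 - i \<in> {1..4}\<close>] assms by simp
  then show "visit C standard m \<noteq> ((length L + 6, k + i), Up)"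
    using visit_one_direction[of m "l' + 6"] by (simp add: half_twist_completed)
qed

lemma transpose_outside:
  assumes "half_twist_word \<beta>" "s < 6" "i \<notin> {k + 1..k + 4}"
  shows "transpose (k + \<beta> ! s) (Suc (k + \<beta> ! s)) i = i"
  using letter_bounds[OF assms(1,2)] assms(3) by (auto simp: transpose_def)

lemma not_interior_inward:
  assumes "half_twist_word \<beta>"
  shows "\<not> interior (fst (inward (completed \<beta>) p))" "\<not> interior (fst (outward (completed \<beta>) p))"
  using assms by (cases p; simp add: interior_def length_completed)+

lemma inward_completed:
  assumes "half_twist_word \<beta>" "half_twist_word \<gamma>"
  shows "inward (completed \<beta>) p = inward (completed \<gamma>) p"
    and "outward (completed \<beta>) p = outward (completed \<gamma>) p"
  using assms by (cases p; simp add: length_completed)+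

text \<open>The excluded states are about to enter the half twist from above or from below. Any
  other outside state meets a slice of \<open>L\<close> or \<open>U\<close>, leaves the diagram, or
  passes a letter beside the four branches, where the letter acts trivially.\<close>

lemma circle_step_outside:
  assumes \<beta>: "half_twist_word \<beta>" and \<gamma>: "half_twist_word \<gamma>"
    and x: "\<not> interior (fst x)" "\<And>i. i \<in> {1..4} \<Longrightarrow> x \<noteq> entry i"
      "\<And>i. i \<in> {1..4} \<Longrightarrow> x \<noteq> ((length L + 6, k + i), Up)"
  shows "circle_step C (completed \<beta>) x = circle_step C (completed \<gamma>) x"
    and "\<not> interior (fst (circle_step C (completed \<gamma>) x))"
proof -
  obtain t i d where xt: "x = ((t, i), d)" by (cases x) auto
  have "circle_step C (completed \<beta>) x = circle_step C (completed \<gamma>) x \<and>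
    \<not> interior (fst (circle_step C (completed \<gamma>) x))"
  proof (cases d)
    case Down
    have side: "i \<notin> {k + 1..k + 4}" if "length L \<le> t" "t < length L + 6"
    proof
      assume i: "i \<in> {k + 1..k + 4}"
      with that x(1) xt have "t = length L" by (auto simp: interior_def)
      moreover have "i - k \<in> {1..4}" "k + (i - k) = i" using i by auto
      ultimately show False using Down xt x(2)[of "i - k"] by (simp add: entry_def)
    qed
    consider "t < length L" | "length L \<le> t" "t < length L + 6" | "length L + 6 \<le> t" by linarith
    then show ?thesis
    proof cases
      case 1
      then show ?thesis using \<beta> \<gamma> Down xt
        by (cases "L ! t") (auto simp: circle_step_def nth_completed length_completed interior_def)
    next
      case 2
      then have s: "t - length L < 6" by linarith
      show ?thesis using \<beta> \<gamma> Down xt 2 side[OF 2] transpose_outside[OF \<beta> s side[OF 2]]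
          transpose_outside[OF \<gamma> s side[OF 2]]
        by (auto simp: circle_step_def nth_completed length_completed interior_def)
    next
      case 3
      then show ?thesis
        using \<beta> \<gamma> Down xt inward_completed(1)[OF \<beta> \<gamma>] not_interior_inward(1)[OF \<gamma>]
        by (cases "U ! (t - length L - 6)")
          (auto simp: circle_step_def nth_completed length_completed interior_def)
    qed
  next
    case Up
    have side: "i \<notin> {k + 1..k + 4}" if "length L < t" "t \<le> length L + 6"
    proof
      assume i: "i \<in> {k + 1..k + 4}"
      with that x(1) xt have "t = length L + 6" by (auto simp: interior_def)
      moreover have "i - k \<in> {1..4}" "k + (i - k) = i" using i by auto
      ultimately show False using Up xt x(3)[of "i - k"] by simp
    qed
    consider "t \<le> length L" | "length L < t" "t \<le> length L + 6" | "length L + 6 < t" by linarith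
    then show ?thesis
    proof cases
      case 1
      then show ?thesis
        using \<beta> \<gamma> Up xt inward_completed(1)[OF \<beta> \<gamma>] not_interior_inward(1)[OF \<gamma>]
        by (cases "L ! (t - 1)")
          (auto simp: circle_step_def nth_completed length_completed interior_def)
    next
      case 2
      then have s: "t - 1 - length L < 6" by linarith
      show ?thesis using \<beta> \<gamma> Up xt 2 side[OF 2] transpose_outside[OF \<beta> s side[OF 2]]
          transpose_outside[OF \<gamma> s side[OF 2]]
        by (auto simp: circle_step_def nth_completed length_completed interior_def)
    next
      case 3
      then show ?thesis using \<beta> \<gamma> Up xt
        by (cases "U ! (t - 1 - length L - 6)")
          (auto simp: circle_step_def nth_completed length_completed interior_def)
    qed
  qed
  then show "circle_step C (completed \<beta>) x = circle_step C (completed \<gamma>) x"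
    and "\<not> interior (fst (circle_step C (completed \<gamma>) x))" by blast+
qed

lemma interior_on_branch:
  assumes "half_twist_word \<beta>" "j \<in> {1..4}"
  shows "interior (fst (on_branch \<beta> s j)) \<longleftrightarrow> s \<in> {1..5}"
  using track_take_bounds[OF assms, of s] by (auto simp: on_branch_def interior_def)

text \<open>All half twist words have six letters, so the two diagrams are traversed in step.\<close>

lemma visit_agree:
  assumes \<beta>: "half_twist_word \<beta>"
  shows "\<not> interior (fst (visit C standard m)) \<and> visit C (completed \<beta>) m = visit C standard m \<or>
    (\<exists>s \<in> {1..5}. \<exists>j \<in> {1..4}. \<exists>l. m = l + s \<and> visit C standard l = entry j \<and>
      visit C (completed \<beta>) m = on_branch \<beta> s j)" (is "?outside m \<or> ?inside m")
proof (induction m)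
  case 0
  have "?outside 0"
    using inward_completed[OF \<beta> half_twist_word_standard]
      not_interior_inward[OF half_twist_word_standard] by (simp add: visit_0)
  then show ?case ..
next
  case (Suc m)
  then show ?case
  proof
    assume outside: "?outside m"
    show ?thesis
    proof (cases "\<exists>j \<in> {1..4}. visit C standard m = entry j")
      case True
      then obtain j where j: "j \<in> {1..4}" "visit C standard m = entry j" by blast
      with outside have "visit C (completed \<beta>) m = on_branch \<beta> 0 j" by (simp add: on_branch_0)
      then have "visit C (completed \<beta>) (Suc m) = on_branch \<beta> 1 j"
        using circle_step_on_branch[OF \<beta>, of 0 j] by (simp add: visit_Suc)
      moreover have "Suc m = m + 1" "(1::nat) \<in> {1..5}" by simp_all
      ultimately have "?inside (Suc m)" using j by blast
      then show ?thesis ..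
    next
      case False
      then have "circle_step C (completed \<beta>) (visit C standard m) = circle_step C standard (visit C standard m)"
        and "\<not> interior (fst (circle_step C standard (visit C standard m)))"
        using circle_step_outside[OF \<beta> half_twist_word_standard, of "visit C standard m"]
          not_upwards(2) outside by blast+
      with outside have "?outside (Suc m)" by (simp add: visit_Suc)
      then show ?thesis ..
    qed
  next
    assume "?inside m"
    then obtain s j l where s: "s \<in> {1..5}" and j: "j \<in> {1..4}" and l: "m = l + s"
        "visit C standard l = entry j"
      and m: "visit C (completed \<beta>) m = on_branch \<beta> s j" by blast
    have next_m: "visit C (completed \<beta>) (Suc m) = on_branch \<beta> (Suc s) j"
      using circle_step_on_branch[OF \<beta>, of s j] s m by (simp add: visit_Suc)
    show ?thesis
    proof (cases "s = 5")
      case True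
      \<comment> \<open>Both words reverse the four positions with six letters, so the two
        traversals come together again at this time.\<close>
      have "visit C standard (Suc m) = on_branch standard_word 6 j"
        using follow_branch[OF half_twist_word_standard l(2), of 6] True l(1) by (simp add: add.commute)
      also have "\<dots> = on_branch \<beta> (Suc s) j"
        using on_branch_6[OF \<beta> j] on_branch_6[OF half_twist_word_standard j] True by simp
      finally have std: "visit C standard (Suc m) = on_branch \<beta> (Suc s) j" .
      then have "\<not> interior (fst (visit C standard (Suc m)))"
        using True interior_on_branch[OF \<beta> j] by simp
      with std next_m show ?thesis by simp
    next
      case False
      with s have "Suc s \<in> {1..5}" "Suc m = l + Suc s" using l(1) by auto
      then have "?inside (Suc m)" using j l(2) next_m by blast
      then show ?thesis ..
    qed
  qed
qed

text \<open>The two diagrams can only disagree while the circle is on a branch, and then its states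
  are interior in both.\<close>

lemma visit_outside:
  assumes "half_twist_word \<beta>" "\<not> interior x"
  shows "visit C (completed \<beta>) m = (x, d) \<longleftrightarrow> visit C standard m = (x, d)"
  using visit_agree[OF assms(1), of m]
proof
  assume "\<not> interior (fst (visit C standard m)) \<and> visit C (completed \<beta>) m = visit C standard m"
  then show ?thesis by simp
next
  assume "\<exists>s \<in> {1..5}. \<exists>j \<in> {1..4}. \<exists>l. m = l + s \<and> visit C standard l = entry j \<and>
      visit C (completed \<beta>) m = on_branch \<beta> s j"
  then obtain s j l where s: "s \<in> {1..5}" and j: "j \<in> {1..4}" and l: "m = l + s"
      "visit C standard l = entry j" and m: "visit C (completed \<beta>) m = on_branch \<beta> s j" by blast
  have "visit C standard m = on_branch standard_word s j"
    using follow_branch[OF half_twist_word_standard l(2), of s] s l(1) by simp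
  then have "interior (fst (visit C standard m))"
    using interior_on_branch[OF half_twist_word_standard j] s by simp
  moreover have "interior (fst (visit C (completed \<beta>) m))"
    using m interior_on_branch[OF assms(1) j] s by simp
  ultimately show ?thesis using assms(2) by auto
qed

lemma fst_visit_outside:
  assumes "half_twist_word \<beta>" "\<not> interior x"
  shows "fst (visit C (completed \<beta>) m) = x \<longleftrightarrow> fst (visit C standard m) = x"
  using visit_outside[OF assms] by (metis prod.collapse)

section \<open>Times of entry and passages inside the half twist\<close>

definition E :: "nat \<Rightarrow> nat" where
  "E j = (LEAST m. visit C standard m = entry j)"

lemma visit_E: "j \<in> {1..4} \<Longrightarrow> visit C standard (E j) = entry j"
  unfolding E_def by (erule branch_entered) (rule LeastI)

lemma E_le: "visit C standard m = entry j \<Longrightarrow> E j \<le> m"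
  unfolding E_def by (rule Least_le)

lemma visit_branch:
  assumes "half_twist_word \<beta>" "j \<in> {1..4}" "s \<le> 6"
  shows "visit C (completed \<beta>) (E j + s) = on_branch \<beta> s j"
proof (rule follow_branch)
  have "\<not> interior (fst (entry j))" by (simp add: entry_def interior_def)
  then show "visit C (completed \<beta>) (E j) = entry j"
    using visit_outside[OF assms(1), of "fst (entry j)" "E j" "snd (entry j)"] visit_E[OF assms(2)] by simp
qed (use assms in auto)

text \<open>Supplies the minimality of the times in \<open>passage_inside\<close> and
  \<open>met_inside\<close>: an interior point is reached only along a branch, after that branch was
  entered.\<close>

lemma visit_branchD:
  assumes \<beta>: "half_twist_word \<beta>" and j: "j \<in> {1..4}" and s: "s < 6"
    and m: "visit C (completed \<beta>) m = ((length L + s, k + track (take s \<beta>) j), d)"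
  shows "d = Down" "E j + s \<le> m"
proof -
  have i: "track (take s \<beta>) j \<in> {1..4}" by (rule track_take_bounds[OF \<beta> j])
  have "d = Down \<and> E j + s \<le> m"
  proof (cases "s = 0")
    case True
    have "\<not> interior (length L, k + j)" by (simp add: interior_def)
    then have "visit C standard m = ((length L, k + j), d)"
      using visit_outside[OF \<beta>, of "(length L, k + j)" m d] m True by simp
    moreover from this have "d = Down" using not_upwards(1)[OF j, of m] by (cases d) auto
    ultimately show ?thesis using True E_le[of m j] by (simp add: entry_def)
  next
    case False
    then have int: "interior (length L + s, k + track (take s \<beta>) j)"
      using s i by (auto simp: interior_def)
    from visit_agree[OF \<beta>, of m] show ?thesis
    proof
      assume "\<not> interior (fst (visit C standard m)) \<and> visit C (completed \<beta>) m = visit C standard m"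
      with m int show ?thesis by simp
    next
      assume "\<exists>s \<in> {1..5}. \<exists>j \<in> {1..4}. \<exists>l. m = l + s \<and> visit C standard l = entry j \<and>
        visit C (completed \<beta>) m = on_branch \<beta> s j"
      then obtain s' j' l where l: "m = l + s'" "visit C standard l = entry j'"
        and m': "visit C (completed \<beta>) m = on_branch \<beta> s' j'" by blast
      have sd: "s' = s" "d = Down" and "track (take s \<beta>) j' = track (take s \<beta>) j"
        using trans[OF m'[symmetric] m] by (auto simp: on_branch_def)
      \<comment> \<open>The permutation by the letters read so far is injective, so the position
        identifies the branch.\<close>
      then have "j' = j" by (metis track_rev_track)
      then show ?thesis using E_le[OF l(2)] l(1) sd by simp
    qed
  qed
  then show "d = Down" "E j + s \<le> m" by blast+
qed

lemma not_upwards_inside: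
  assumes \<beta>: "half_twist_word \<beta>" and j: "j \<in> {1..4}" and s: "s \<le> 6"
  shows "visit C (completed \<beta>) m \<noteq> ((length L + s, k + track (take s \<beta>) j), Up)"
proof (cases "s = 6")
  case True
  have "\<not> interior (length L + 6, k + track (take s \<beta>) j)" by (simp add: interior_def)
  then show ?thesis
    using visit_outside[OF \<beta>, of "(length L + 6, k + track (take s \<beta>) j)" m Up] True
      not_upwards(2)[OF track_take_bounds[OF \<beta> j], of m s] by simp
next
  case False
  with s have "s < 6" by simp
  then show ?thesis using visit_branchD(1)[OF \<beta> j] by auto
qed

lemma interior_branch_standard:
  assumes "j \<in> {1..4}" "s \<in> {1..5}"
  shows "interior (fst (visit C standard (E j + s)))"
  using assms visit_branch[OF half_twist_word_standard, of j s]
    interior_on_branch[OF half_twist_word_standard, of j s] by simp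

text \<open>The five steps after an entry are interior, so an outside time cannot be one of
  them.\<close>

lemma before_outside:
  assumes "j \<in> {1..4}" "s < 6" "\<not> interior (fst (visit C standard m))"
  shows "E j + s < m \<longleftrightarrow> E j < m"
proof (rule ccontr)
  assume "\<not> ?thesis"
  then have "E j < m" "m \<le> E j + s" by auto
  then have "m = E j + (m - E j)" "m - E j \<in> {1..5}" using assms(2) by auto
  then have "interior (fst (visit C standard m))"
    using interior_branch_standard[OF assms(1)] by metis
  with assms(3) show False by simp
qed

text \<open>In this direction \<open>m = E j\<close> would satisfy only the left side if
  \<open>s > 0\<close>, so the state of entry has to be excluded too.\<close>

lemma after_outside:
  assumes "j \<in> {1..4}" "s < 6" "\<not> interior (fst (visit C standard m))" "visit C standard m \<noteq> entry j"
  shows "m < E j + s \<longleftrightarrow> m < E j"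
proof -
  have "m \<noteq> E j" using assms(1,4) visit_E by auto
  then show ?thesis using before_outside[OF assms(1-3)] assms(2) by auto
qed

text \<open>An entry is not interior, hence not among the five steps following another entry. Thus
  offsets below six never change the order of two branches.\<close>

lemma E_separated:
  assumes "i \<in> {1..4}" "j \<in> {1..4}" "i \<noteq> j"
  shows "E i + 6 \<le> E j \<or> E j + 6 \<le> E i"
proof -
  have entry: "\<not> interior (fst (visit C standard (E l)))" if "l \<in> {1..4}" for l
    using visit_E[OF that] by (simp add: entry_def interior_def)
  have "E i \<noteq> E j" using visit_E[OF assms(1)] visit_E[OF assms(2)] assms(3) by (auto simp: entry_def)
  then show ?thesis
    using before_outside[OF assms(1) _ entry[OF assms(2)], of 5]
      before_outside[OF assms(2) _ entry[OF assms(1)], of 5] by auto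
qed

lemma passage_inside:
  assumes "half_twist_word \<beta>" "j \<in> {1..4}" "s < 6"
  shows "passage C (completed \<beta>) (length L + s) (k + track (take s \<beta>) j) = E j + s"
  unfolding passage_def
proof (rule Least_equality)
  show "visit C (completed \<beta>) (E j + s) = ((length L + s, k + track (take s \<beta>) j), Down) \<or>
    visit C (completed \<beta>) (E j + s) = (fst (go_down (completed \<beta> ! (length L + s)) (length L + s)
      (k + track (take s \<beta>) j)), Up)"
    using visit_branch[OF assms(1,2)] assms(3) by (simp add: on_branch_def)
next
  fix m
  assume "visit C (completed \<beta>) m = ((length L + s, k + track (take s \<beta>) j), Down) \<or>
    visit C (completed \<beta>) m = (fst (go_down (completed \<beta> ! (length L + s)) (length L + s)
      (k + track (take s \<beta>) j)), Up)"
  then show "E j + s \<le> m"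
  proof
    assume "visit C (completed \<beta>) m = ((length L + s, k + track (take s \<beta>) j), Down)"
    then show ?thesis by (rule visit_branchD(2)[OF assms])
  next
    have "s < length \<beta>" using assms by (simp add: half_twist_word_def)
    then have "fst (go_down (completed \<beta> ! (length L + s)) (length L + s) (k + track (take s \<beta>) j)) =
        (length L + Suc s, k + track (take (Suc s) \<beta>) j)"
      using assms track_take_Suc[of s \<beta> j] transpose_add[of k "\<beta> ! s" "track (take s \<beta>) j"]
      by (simp add: nth_completed)
    moreover assume "visit C (completed \<beta>) m = (fst (go_down (completed \<beta> ! (length L + s))
      (length L + s) (k + track (take s \<beta>) j)), Up)"
    ultimately show ?thesis using not_upwards_inside[OF assms(1,2), of "Suc s" m] assms(3) by simp
  qed
qed

lemma met_inside:
  assumes "half_twist_word \<beta>" "j \<in> {1..4}" "s < 6"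
  shows "met C (completed \<beta>) (length L + s, k + track (take s \<beta>) j) = E j + s"
  unfolding met_def
proof (rule Least_equality)
  show "fst (visit C (completed \<beta>) (E j + s)) = (length L + s, k + track (take s \<beta>) j)"
    using visit_branch[OF assms(1,2)] assms(3) by (simp add: on_branch_def)
next
  fix m assume "fst (visit C (completed \<beta>) m) = (length L + s, k + track (take s \<beta>) j)"
  then show "E j + s \<le> m" using visit_branchD(2)[OF assms] by (metis prod.collapse)
qed

lemma met_outside:
  assumes "half_twist_word \<beta>" "\<not> interior x"
  shows "met C (completed \<beta>) x = met C standard x"
  unfolding met_def fst_visit_outside[OF assms] ..

lemma met_end_completed:
  assumes "half_twist_word \<beta>"
  shows "met_end C (completed \<beta>) p = met_end C standard p"
  unfolding met_end_def inward_completed(1)[OF assms half_twist_word_standard]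
  by (rule met_outside[OF assms not_interior_inward(1)[OF half_twist_word_standard]])

lemma met_end_not_interior:
  assumes "p \<in> endpoints C"
  shows "\<not> interior (fst (visit C standard (met_end C standard p)))"
proof -
  obtain m where "fst (visit C standard m) = fst (inward standard p)"
    using endpoint_visited[OF assms] unfolding half_twist_completed .
  then have "fst (visit C standard (met_end C standard p)) = fst (inward standard p)"
    unfolding met_end_def met_def by (rule LeastI)
  then show ?thesis using not_interior_inward(1)[OF half_twist_word_standard] by simp
qed

text \<open>This is \<open>crossing_grading\<close> for under branch \<open>i\<close> and over
  branch \<open>j\<close>, with times of entry in place of passage times, which frees it from the
  perturbation.\<close>

definition branch_grading :: "nat \<Rightarrow> nat \<Rightarrow> endpoint set" where
  "branch_grading i j = {p \<in> endpoints C. E j < met_end C standard p \<or> met_end C standard p \<le> E i}"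

text \<open>Both branches reach letter \<open>s\<close> with the same delay \<open>s\<close>, so the
  type compares times of entry. Boundary points are met at outside times, so
  \<open>before_outside\<close> removes the delay from the grading. Both branches run down through
  \<open>Sig\<close>, hence the writhe.\<close>

lemma crossing_inside:
  assumes \<beta>: "half_twist_word \<beta>" and s: "s < 6" and i: "i \<in> {1..4}" "track (take s \<beta>) i = \<beta> ! s"
    and j: "j \<in> {1..4}" "track (take s \<beta>) j = \<beta> ! s + 1"
  shows "under_time C (completed \<beta>) (length L + s) = E i + s"
    and "over_time C (completed \<beta>) (length L + s) = E j + s"
    and "type1 C (completed \<beta>) (length L + s) \<longleftrightarrow> E i < E j"
    and "crossing_grading C (completed \<beta>) (length L + s) = branch_grading i j"
    and "writhe C (completed \<beta>) (length L + s) = 1"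
proof -
  have slice: "completed \<beta> ! (length L + s) = Sig (k + \<beta> ! s)"
    using s by (simp add: nth_completed[OF \<beta>])
  show u: "under_time C (completed \<beta>) (length L + s) = E i + s"
    using passage_inside[OF \<beta> i(1) s] i(2) by (simp add: under_time_def slice)
  show o: "over_time C (completed \<beta>) (length L + s) = E j + s"
    using passage_inside[OF \<beta> j(1) s] j(2) by (simp add: over_time_def slice)
  show "type1 C (completed \<beta>) (length L + s) \<longleftrightarrow> E i < E j"
    by (simp add: type1_def u o)
  show "crossing_grading C (completed \<beta>) (length L + s) = branch_grading i j"
    unfolding crossing_grading_def branch_grading_def u o met_end_completed[OF \<beta>]
    using before_outside[OF i(1) s met_end_not_interior] before_outside[OF j(1) s met_end_not_interior]
    by (auto simp: not_less[symmetric])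
  have "runs_down C (completed \<beta>) (length L + s, k + track (take s \<beta>) l)" if "l \<in> {1..4}" for l
    using visit_branch[OF \<beta> that, of s] s by (auto simp: runs_down_def on_branch_def)
  then have "runs_down C (completed \<beta>) (length L + s, k + \<beta> ! s)"
    "runs_down C (completed \<beta>) (length L + s, Suc (k + \<beta> ! s))"
    using i j by (force, force)
  then show "writhe C (completed \<beta>) (length L + s) = 1"
    by (simp add: writhe_def slice)
qed

section \<open>Crossings outside the half twist\<close>

definition outside :: "nat set" where
  "outside = {q. q < length L \<or> length L + 6 \<le> q}"

lemma nth_completed_outside:
  assumes "half_twist_word \<beta>" "q \<in> outside"
  shows "completed \<beta> ! q = standard ! q"
  using assms by (auto simp: nth_completed half_twist_word_standard outside_def)

lemma crossing_outside:
  assumes "half_twist_word \<beta>" "q \<in> outside"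
  shows "crossing (completed \<beta>) q \<longleftrightarrow> crossing standard q"
  using nth_completed_outside[OF assms]
  by (simp add: crossing_def length_completed[OF assms(1)] length_completed[OF half_twist_word_standard])

lemma passage_outside:
  assumes "half_twist_word \<beta>" "q \<in> outside" "crossing standard q"
  shows "passage C (completed \<beta>) q i = passage C standard q i"
proof -
  obtain j where j: "standard ! q = Sig j \<or> standard ! q = SigInv j"
    using assms(3) unfolding crossing_def by blast
  have "\<not> interior (q, i)" "\<not> interior (fst (go_down (standard ! q) q i))"
    using assms(2) j by (auto simp: interior_def outside_def)
  then show ?thesis
    by (simp add: passage_def visit_outside[OF assms(1)] nth_completed_outside[OF assms(1,2)])
qed

lemma times_outside:
  assumes "half_twist_word \<beta>" "q \<in> outside" "crossing standard q"
  shows "under_time C (completed \<beta>) q = under_time C standard q"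
    and "over_time C (completed \<beta>) q = over_time C standard q"
  using passage_outside[OF assms] nth_completed_outside[OF assms(1,2)]
  by (simp_all add: under_time_def over_time_def)

lemma writhe_outside:
  assumes "half_twist_word \<beta>" "q \<in> outside"
  shows "writhe C (completed \<beta>) q = writhe C standard q"
proof -
  have "\<not> interior (q, i)" for i using assms(2) by (auto simp: interior_def outside_def)
  then show ?thesis
    by (simp add: writhe_def runs_down_def visit_outside[OF assms(1)] nth_completed_outside[OF assms])
qed

lemma under_time_outside_less:
  assumes "q \<in> outside" "crossing standard q" "j \<in> {1..4}" "s < 6"
  shows "under_time C standard q < E j + s \<longleftrightarrow> under_time C standard q < E j"
proof -
  obtain l where q: "q < length standard" and l: "standard ! q = Sig l \<or> standard ! q = SigInv l"
    using assms(2) unfolding crossing_def by blast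
  define i where "i = under_position (standard ! q)"
  have i: "i \<in> {l, l + 1}" using l by (auto simp: i_def)
  define P where "P m \<longleftrightarrow> visit C standard m = ((q, i), Down) \<or>
    visit C standard m = (fst (go_down (standard ! q) q i), Up)" for m
  obtain m where "visit C standard m = ((q, i), Down) \<or>
      visit C standard m = ((Suc q, transpose l (l + 1) i), Up)"
    using crossing_visited[of q l i] q l i unfolding half_twist_completed by blast
  then have "P m" using l by (auto simp: P_def)
  then have "P (under_time C standard q)"
    unfolding under_time_def passage_def i_def[symmetric] P_def[symmetric] by (rule LeastI)
  moreover have "\<not> interior (q, i)" "\<not> interior (fst (go_down (standard ! q) q i))"
    using assms(1) l by (auto simp: interior_def outside_def)
  \<comment> \<open>The first slice of the half twist is not outside, so a downward state just above
    an outside crossing is not an entry.\<close>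
  moreover have "q \<noteq> length L" using assms(1) by (auto simp: outside_def)
  ultimately have "\<not> interior (fst (visit C standard (under_time C standard q)))"
    "visit C standard (under_time C standard q) \<noteq> entry j"
    by (auto simp: P_def entry_def)
  then show ?thesis by (rule after_outside[OF assms(3,4)])
qed

lemma type1_outside:
  assumes "half_twist_word \<beta>" "q \<in> outside" "crossing standard q"
  shows "type1 C (completed \<beta>) q \<longleftrightarrow> type1 C standard q"
  by (simp add: type1_def times_outside[OF assms])

lemma crossing_grading_outside:
  assumes "half_twist_word \<beta>" "q \<in> outside" "crossing standard q"
  shows "crossing_grading C (completed \<beta>) q = crossing_grading C standard q"
  by (simp add: crossing_grading_def times_outside[OF assms] met_end_completed[OF assms(1)])

text \<open>Reversing a word inverts its permutation, so this traces the left strand at letter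
  \<open>s\<close>, the under strand of \<open>Sig\<close>, back to its branch.\<close>

definition lower :: "nat list \<Rightarrow> nat \<Rightarrow> nat" where
  "lower \<beta> s = track (rev (take s \<beta>)) (\<beta> ! s)"

definition upper :: "nat list \<Rightarrow> nat \<Rightarrow> nat" where
  "upper \<beta> s = track (rev (take s \<beta>)) (\<beta> ! s + 1)"

lemma track_lower_upper:
  assumes "half_twist_word \<beta>" "s < 6"
  shows "lower \<beta> s \<in> {1..4}" "track (take s \<beta>) (lower \<beta> s) = \<beta> ! s"
    and "upper \<beta> s \<in> {1..4}" "track (take s \<beta>) (upper \<beta> s) = \<beta> ! s + 1"
proof -
  have "set (rev (take s \<beta>)) \<subseteq> {1, 2, 3}"
    using assms(1) set_take_subset[of s \<beta>] unfolding half_twist_word_def by auto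
  then show "lower \<beta> s \<in> {1..4}" "upper \<beta> s \<in> {1..4}"
    using letter_bounds[OF assms] track_bounds unfolding lower_def upper_def by simp_all
qed (simp_all add: lower_def upper_def track_track_rev)

section \<open>Triple crossings of the meridian: types, gradings and \<open>W\<close>\<close>

definition triple :: "nat list \<Rightarrow> nat \<Rightarrow> nat list \<Rightarrow> triple_crossing" where
  "triple u i w = \<lparr>above = L @ braid_at k u, offset = k + i - 1, below = braid_at k w @ U\<rparr>"

lemma move_triple: "move L k U s u i w = (s, triple u i w)"
  by (simp add: move_def triple_def)

lemma plug_triple:
  assumes "1 \<le> i"
  shows "plug (triple u i w) \<gamma> = completed (u @ map (\<lambda>a. i - 1 + a) \<gamma> @ w)"
  using assms by (auto simp: plug_def triple_def completed_def braid_at_def)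

lemma length_above_triple: "length (above (triple u i w)) = length L + length u"
  by (simp add: triple_def)

text \<open>The block \<open>[i, i + 1, i]\<close> is the perturbation chosen in
  \<open>perturbed\<close>, whichever side of the move comes first.\<close>

definition branches :: "nat list \<Rightarrow> nat \<Rightarrow> nat list \<Rightarrow> nat \<Rightarrow> nat \<Rightarrow> nat \<Rightarrow> bool" where
  "branches u i w low mid high \<longleftrightarrow>
     half_twist_word (u @ [i, i + 1, i] @ w) \<and> {low, mid, high} \<subseteq> {1..4} \<and>
     track u low = i \<and> track u mid = i + 1 \<and> track u high = i + 2"

text \<open>The share of outside crossings in \<open>W\<close>; it sees the triple crossing only
  through the entry of the over branch of \<open>d\<close>.\<close>

definition outer_W :: "endpoint set \<Rightarrow> nat \<Rightarrow> int" where
  "outer_W A j = (\<Sum>q \<in> {q \<in> outside. crossing standard q \<and> type1 C standard q \<and>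
     under_time C standard q < E j \<and> crossing_grading C standard q = A}. writhe C standard q)"

context
  fixes u w :: "nat list" and i low mid high :: nat
  assumes br: "branches u i w low mid high"
begin

private abbreviation (input) word :: "nat list" where
  "word \<equiv> u @ [i, i + 1, i] @ w"

private lemma word: "half_twist_word word"
  and low: "low \<in> {1..4}" "track u low = i"
  and mid: "mid \<in> {1..4}" "track u mid = i + 1"
  and high: "high \<in> {1..4}" "track u high = i + 2"
  using br by (simp_all add: branches_def)

private lemma position: "1 \<le> i"
  using word by (auto simp: half_twist_word_def)

private lemma len: "length u + 3 \<le> 6"
  using word by (simp add: half_twist_word_def)

lemma perturbed_triple: "perturbed (triple u i w) = completed word"
  using plug_triple[OF position, of u w "[1, 2, 1]"] position by (simp add: perturbed_def)

lemma met_triple: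
  "met_low C (triple u i w) = E low + length u"
  "met_mid C (triple u i w) = E mid + length u"
  "met_high C (triple u i w) = E high + length u"
  using met_inside[OF word low(1), of "length u"] met_inside[OF word mid(1), of "length u"]
    met_inside[OF word high(1), of "length u"] len position low(2) mid(2) high(2)
  by (simp_all add: met_low_def met_mid_def met_high_def perturbed_triple length_above_triple)
    (simp_all add: triple_def)

text \<open>Both types say that the mid branch is met first. They differ in the order of the other
  two branches, whose times are distinct.\<close>

lemma type_lc_or_ra:
  "type_lc C (triple u i w) \<or> type_ra C (triple u i w) \<longleftrightarrow> E mid < E low \<and> E mid < E high"
proof -
  have "low \<noteq> high" using low(2) high(2) by auto
  then have "E low \<noteq> E high" using E_separated[OF low(1) high(1)] by auto
  then show ?thesis by (auto simp: type_lc_def type_ra_def met_triple)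
qed

private lemma crossing_d_tracks:
  "length u + 1 < 6" "word ! (length u + 1) = i + 1"
  "track (take (length u + 1) word) low = word ! (length u + 1)"
  "track (take (length u + 1) word) high = word ! (length u + 1) + 1"
  using len low(2) high(2) by (simp_all add: nth_append track_append transpose_def)

private lemma crossing_hm_tracks:
  "length u + 2 < 6" "word ! (length u + 2) = i"
  "track (take (length u + 2) word) mid = word ! (length u + 2)"
  "track (take (length u + 2) word) high = word ! (length u + 2) + 1"
  using len mid(2) high(2) by (simp_all add: nth_append track_append transpose_def)

private lemma crossing_d_triple: "crossing_d (triple u i w) = length L + (length u + 1)"
  by (simp add: crossing_d_def length_above_triple)

lemma d_type0_iff: "d_type0 C (triple u i w) \<longleftrightarrow> E high < E low"
proof -
  have "low \<noteq> high" using low(2) high(2) by auto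
  then have "E low \<noteq> E high" using E_separated[OF low(1) high(1)] by auto
  moreover have "d_type0 C (triple u i w) \<longleftrightarrow> \<not> E low < E high"
    unfolding d_type0_def perturbed_triple crossing_d_triple
    by (subst crossing_inside(3)[OF word crossing_d_tracks(1) low(1) crossing_d_tracks(3) high(1)
          crossing_d_tracks(4)]) simp
  ultimately show ?thesis by auto
qed

lemma hm_grading_triple: "hm_grading C (triple u i w) = branch_grading mid high"
  using crossing_inside(4)[OF word crossing_hm_tracks(1) mid(1) crossing_hm_tracks(3) high(1)
          crossing_hm_tracks(4)]
  unfolding hm_grading_def perturbed_triple crossing_hm_def length_above_triple by (simp add: add.assoc)

text \<open>The f-crossings are split at the border of the half twist. Outside, the offset of
  \<open>d\<close> drops out by \<open>under_time_outside_less\<close>; inside, all writhes are 1,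
  so letters are merely counted.\<close>

lemma W_triple:
  assumes type0: "E high < E low"
  shows "W C A (triple u i w) = outer_W A high +
    (\<Sum>s<6. of_bool (E (lower word s) < E (upper word s) \<and>
      E (lower word s) + s < E high + (length u + 1) \<and>
      branch_grading (lower word s) (upper word s) = A))"
proof -
  define P where "P s \<longleftrightarrow> E (lower word s) < E (upper word s) \<and>
      E (lower word s) + s < E high + (length u + 1) \<and>
      branch_grading (lower word s) (upper word s) = A" for s
  define F where "F = {q \<in> f_crossings C (triple u i w).
      crossing_grading C (completed word) q = A}"
  define d where "d = length L + (length u + 1)"
  have F_iff: "q \<in> F \<longleftrightarrow> crossing (completed word) q \<and> q \<noteq> d \<and> type1 C (completed word) q \<and>
      under_time C (completed word) q < E high + (length u + 1) \<and>
      crossing_grading C (completed word) q = A" for q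
    unfolding F_def f_crossings_def perturbed_triple crossing_d_triple d_def
    using crossing_inside(2)[OF word crossing_d_tracks(1) low(1) crossing_d_tracks(3) high(1)
          crossing_d_tracks(4)] by simp
  have outer: "F \<inter> outside = {q \<in> outside. crossing standard q \<and> type1 C standard q \<and>
     under_time C standard q < E high \<and> crossing_grading C standard q = A}"
  proof -
    have "q \<noteq> d" if "q \<in> outside" for q
      using that crossing_d_tracks(1) by (auto simp: outside_def d_def)
    then show ?thesis
      using crossing_outside[OF word] times_outside(1)[OF word] type1_outside[OF word]
        crossing_grading_outside[OF word] crossing_d_tracks(1)
        under_time_outside_less[OF _ _ high(1), of _ "length u + 1"]
      by (auto simp: F_iff)
  qed
  have inner: "length L + s \<in> F \<longleftrightarrow> P s" if s: "s < 6" for s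
  proof -
    note inside = crossing_inside[OF word s track_lower_upper[OF word s]]
    have "crossing (completed word) (length L + s)"
      unfolding crossing_def length_completed[OF word] nth_completed[OF word] using s by simp
    \<comment> \<open>Being of type 0, \<open>d\<close> fails the first condition in
      \<open>P\<close>, so counting over all six letters leaves it out.\<close>
    moreover have "\<not> type1 C (completed word) d"
      using type0 crossing_inside(3)[OF word crossing_d_tracks(1) low(1) crossing_d_tracks(3) high(1)
          crossing_d_tracks(4)] by (simp add: d_def)
    then have "length L + s \<noteq> d" if "E (lower word s) < E (upper word s)"
      using that inside(3) by auto
    ultimately show ?thesis unfolding F_iff inside P_def by blast
  qed
  have "finite F"
    by (rule finite_subset[of _ "{..<length (completed word)}"]) (auto simp: F_iff crossing_def)
  have "W C A (triple u i w) = sum (writhe C (completed word)) F"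
    unfolding W_def F_def perturbed_triple ..
  also have "\<dots> = sum (writhe C (completed word)) (F \<inter> outside) + sum (writhe C (completed word)) (F - outside)"
    using sum.Int_Diff[OF \<open>finite F\<close>] .
  also have "sum (writhe C (completed word)) (F \<inter> outside) = outer_W A high"
    unfolding outer_W_def outer using writhe_outside[OF word] by (intro sum.cong) auto
  also have "F - outside = (+) (length L) ` {s \<in> {..<6}. P s}"
  proof (intro equalityI subsetI)
    fix q assume q: "q \<in> F - outside"
    then have "q = length L + (q - length L)" "q - length L < 6" by (auto simp: outside_def)
    with q inner show "q \<in> (+) (length L) ` {s \<in> {..<6}. P s}"
      by (metis (no_types, lifting) DiffD1 imageI lessThan_iff mem_Collect_eq)
  next
    fix q assume "q \<in> (+) (length L) ` {s \<in> {..<6}. P s}"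
    then show "q \<in> F - outside" using inner by (auto simp: outside_def)
  qed
  also have "sum (writhe C (completed word)) ((+) (length L) ` {s \<in> {..<6}. P s}) =
      (\<Sum>s \<in> {s \<in> {..<6}. P s}. writhe C (completed word) (length L + s))"
    by (subst sum.reindex) simp_all
  also have "\<dots> = (\<Sum>s \<in> {s \<in> {..<6}. P s}. 1)"
    using crossing_inside(5)[OF word _ track_lower_upper[OF word]] by (intro sum.cong) auto
  also have "\<dots> = (\<Sum>s<6. of_bool (P s))"
    by (simp add: of_bool_def sum.If_cases Int_def)
  finally show ?thesis unfolding P_def .
qed

end

end

section \<open>Braid words in the skein module\<close>

text \<open>The congruence of the positive braid monoid on four strands, which turns the skein
  identities into manipulations of words.\<close>

inductive braid_equiv :: "nat list \<Rightarrow> nat list \<Rightarrow> bool" where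
  refl: "braid_equiv \<beta> \<beta>"
| sym: "braid_equiv \<beta> \<gamma> \<Longrightarrow> braid_equiv \<gamma> \<beta>"
| trans [trans]: "braid_equiv \<alpha> \<beta> \<Longrightarrow> braid_equiv \<beta> \<gamma> \<Longrightarrow> braid_equiv \<alpha> \<gamma>"
| inside: "braid_equiv \<beta> \<gamma> \<Longrightarrow> braid_equiv (u @ \<beta> @ w) (u @ \<gamma> @ w)"
| far: "braid_equiv [1, 3] [3, 1]"
| braid_12: "braid_equiv [1, 2, 1] [2, 1, 2]"
| braid_23: "braid_equiv [2, 3, 2] [3, 2, 3]"

text \<open>In 321 one strand passes over the three others, in 123 one passes under them, so
  crossings of the others slide past it: moving from left to right, a letter rises by one at 321 and
  drops by one at 123. The next three lemmas are the remaining cases.\<close>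

lemma slide_2_321: "braid_equiv [2, 3, 2, 1] [3, 2, 1, 3]"
proof -
  have "braid_equiv [2, 3, 2, 1] [3, 2, 3, 1]"
    using braid_equiv.inside[OF braid_equiv.braid_23, of "[]" "[1]"] by simp
  also have "braid_equiv [3, 2, 3, 1] [3, 2, 1, 3]"
    using braid_equiv.inside[OF braid_equiv.far[THEN braid_equiv.sym], of "[3, 2]" "[]"] by simp
  finally show ?thesis .
qed

lemma slide_1_321: "braid_equiv [1, 3, 2, 1] [3, 2, 1, 2]"
proof -
  have "braid_equiv [1, 3, 2, 1] [3, 1, 2, 1]"
    using braid_equiv.inside[OF braid_equiv.far, of "[]" "[2, 1]"] by simp
  also have "braid_equiv [3, 1, 2, 1] [3, 2, 1, 2]"
    using braid_equiv.inside[OF braid_equiv.braid_12, of "[3]" "[]"] by simp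
  finally show ?thesis .
qed

lemma slide_3_123: "braid_equiv [3, 1, 2, 3] [1, 2, 3, 2]"
proof -
  have "braid_equiv [3, 1, 2, 3] [1, 3, 2, 3]"
    using braid_equiv.inside[OF braid_equiv.far[THEN braid_equiv.sym], of "[]" "[2, 3]"] by simp
  also have "braid_equiv [1, 3, 2, 3] [1, 2, 3, 2]"
    using braid_equiv.inside[OF braid_equiv.braid_23[THEN braid_equiv.sym], of "[1]" "[]"] by simp
  finally show ?thesis .
qed

lemma slide_2_123: "braid_equiv [2, 1, 2, 3] [1, 2, 3, 1]"
proof -
  have "braid_equiv [2, 1, 2, 3] [1, 2, 1, 3]"
    using braid_equiv.inside[OF braid_equiv.braid_12[THEN braid_equiv.sym], of "[]" "[3]"] by simp
  also have "braid_equiv [1, 2, 1, 3] [1, 2, 3, 1]"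
    using braid_equiv.inside[OF braid_equiv.far, of "[1, 2]" "[]"] by simp
  finally show ?thesis .
qed

text \<open>Makes the first sum vanish for the branches 123 and also for 124, where the same two
  words occur; \<open>equiv_32123\<close> does this for 234.\<close>

lemma equiv_21321: "braid_equiv [2, 1, 3, 2, 1] [3, 2, 1, 3, 2]"
  using braid_equiv.trans[OF braid_equiv.inside[OF slide_1_321, of "[2]" "[]"]]
    braid_equiv.inside[OF slide_2_321[THEN braid_equiv.sym], of "[]" "[2]"]
    braid_equiv.inside[OF slide_2_321, of "[]" "[2]"] by simp

lemma equiv_32123: "braid_equiv [3, 2, 1, 2, 3] [1, 2, 3, 2, 1]"
  using braid_equiv.trans[OF braid_equiv.inside[OF slide_2_123, of "[3]" "[]"]]
    braid_equiv.inside[OF slide_3_123, of "[]" "[1]"] by simp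

text \<open>The chains 22321, 23213, 32133 and 11321, 13212, 32122 lead from one second-sum term of
  123 to the other. They are cut in the middle because 23213 and 13212 are the first-sum words of
  134.\<close>

lemma equiv_22321: "braid_equiv [2, 2, 3, 2, 1] [2, 3, 2, 1, 3]"
  using braid_equiv.inside[OF slide_2_321, of "[2]" "[]"] by simp

lemma equiv_23213: "braid_equiv [2, 3, 2, 1, 3] [3, 2, 1, 3, 3]"
  using braid_equiv.inside[OF slide_2_321, of "[]" "[3]"] by simp

lemma equiv_11321: "braid_equiv [1, 1, 3, 2, 1] [1, 3, 2, 1, 2]"
  using braid_equiv.inside[OF slide_1_321, of "[1]" "[]"] by simp

lemma equiv_13212: "braid_equiv [1, 3, 2, 1, 2] [3, 2, 1, 2, 2]"
  using braid_equiv.inside[OF slide_1_321, of "[]" "[2]"] by simp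

text \<open>This lemma and the next three each match a second-sum word of the branches 124 with one
  of 134.\<close>

lemma equiv_21331: "braid_equiv [2, 1, 3, 3, 1] [2, 3, 1, 1, 3]"
  using braid_equiv.trans[OF braid_equiv.inside[OF braid_equiv.far, of "[2]" "[3, 1]"]]
    braid_equiv.inside[OF braid_equiv.far[THEN braid_equiv.sym], of "[2, 3, 1]" "[]"] by simp

lemma equiv_32232: "braid_equiv [3, 2, 2, 3, 2] [2, 3, 2, 2, 3]"
  using braid_equiv.trans[OF braid_equiv.inside[OF braid_equiv.braid_23, of "[3, 2]" "[]"]]
    braid_equiv.inside[OF braid_equiv.braid_23[THEN braid_equiv.sym], of "[]" "[2, 3]"] by simp

lemma equiv_21221: "braid_equiv [2, 1, 2, 2, 1] [1, 2, 2, 1, 2]"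
  using braid_equiv.trans[OF braid_equiv.inside[OF braid_equiv.braid_12[THEN braid_equiv.sym], of "[]" "[2, 1]"]]
    braid_equiv.inside[OF braid_equiv.braid_12, of "[1, 2]" "[]"] by simp

lemma equiv_31132: "braid_equiv [3, 1, 1, 3, 2] [1, 3, 3, 1, 2]"
  using braid_equiv.trans[OF braid_equiv.inside[OF braid_equiv.far[THEN braid_equiv.sym], of "[]" "[1, 3, 2]"]]
    braid_equiv.inside[OF braid_equiv.far, of "[1, 3]" "[2]"] by simp

text \<open>Here and in \<open>equiv_22123\<close> a squared letter slides past 123, for the second
  sum of the branches 234.\<close>

lemma equiv_33123: "braid_equiv [3, 3, 1, 2, 3] [1, 2, 3, 2, 2]"
  using braid_equiv.trans[OF braid_equiv.inside[OF slide_3_123, of "[3]" "[]"]]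
    braid_equiv.inside[OF slide_3_123, of "[]" "[2]"] by simp

lemma equiv_22123: "braid_equiv [2, 2, 1, 2, 3] [1, 2, 3, 1, 1]"
  using braid_equiv.trans[OF braid_equiv.inside[OF slide_2_123, of "[2]" "[]"]]
    braid_equiv.inside[OF slide_2_123, of "[]" "[1]"] by simp

section \<open>Braid relations as skein relations\<close>

interpretation skein: module scale
  by (rule module_scale)

context quadruple_crossing
begin

definition braid_diagram :: "nat list \<Rightarrow> combination" where
  "braid_diagram \<beta> = Poly_Mapping.single (completed \<beta>) 1"

abbreviation relations :: "combination set" where
  "relations \<equiv> skein.span (skein_relators (tops C) (bots C))"

text \<open>That the half twist fits between \<open>L\<close> and \<open>U\<close> shows that there
  are at least \<open>k + 4\<close> strands, so every word fits, also the resolutions with five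
  letters.\<close>

lemma completed_diagrams:
  assumes "set \<beta> \<subseteq> {1, 2, 3}"
  shows "completed \<beta> \<in> diagrams (tops C) (bots C)"
proof -
  have "standard \<in> diagrams (tops C) (bots C)"
    using string_link unfolding string_link_def half_twist_completed by blast
  then obtain c where c: "target (tops C) L = Some c" "k + 4 \<le> c" "target c U = Some (bots C)"
    by (auto simp: diagrams_def completed_def standard_word_def braid_at_def target_append
        bind_eq_Some_conv split: if_splits)
  have "target c (braid_at k \<beta>) = Some c"
    using assms c(2) by (induction \<beta>) (auto simp: braid_at_def)
  then show ?thesis using c(1,3) by (simp add: diagrams_def completed_def target_append)
qed

lemma isotopy_move_relation:
  assumes "isotopy_move (braid_at k \<beta>) (braid_at k \<gamma>)"
    and "set (u @ \<beta> @ w) \<subseteq> {1, 2, 3}" "set (u @ \<gamma> @ w) \<subseteq> {1, 2, 3}"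
  shows "braid_diagram (u @ \<beta> @ w) - braid_diagram (u @ \<gamma> @ w) \<in> relations"
proof (rule skein.span_base)
  let ?r = "[(1, braid_at k \<beta>), (- 1, braid_at k \<gamma>)] :: (laurent \<times> diagram) list"
  let ?pre = "L @ braid_at k u" and ?post = "braid_at k w @ U"
  have "braid_diagram (u @ \<beta> @ w) - braid_diagram (u @ \<gamma> @ w) = insert_in ?pre ?post ?r"
    by (simp add: braid_diagram_def insert_in_def completed_def braid_at_append single_uminus)
  moreover have "\<forall>(c, v) \<in> set ?r. ?pre @ v @ ?post \<in> diagrams (tops C) (bots C)"
    using completed_diagrams[OF assms(2)] completed_diagrams[OF assms(3)]
    by (simp add: completed_def braid_at_append)
  ultimately show "braid_diagram (u @ \<beta> @ w) - braid_diagram (u @ \<gamma> @ w) \<in>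
      skein_relators (tops C) (bots C)"
    using assms(1) unfolding skein_relators_def by blast
qed

text \<open>The claim on the alphabet goes through the same induction: for \<open>sym\<close> and
  \<open>trans\<close> the other word must give diagrams too. The context \<open>u\<close>,
  \<open>w\<close> is arbitrary because the rule \<open>inside\<close> enlarges it.\<close>

lemma braid_equiv_relation:
  assumes "braid_equiv \<beta> \<gamma>"
  shows "set \<beta> \<subseteq> {1, 2, 3} \<longleftrightarrow> set \<gamma> \<subseteq> {1, 2, 3}"
    and "set (u @ \<beta> @ w) \<subseteq> {1, 2, 3} \<Longrightarrow>
      braid_diagram (u @ \<beta> @ w) - braid_diagram (u @ \<gamma> @ w) \<in> relations"
  using assms
proof (induction arbitrary: u w)
  case refl
  { case 1 then show ?case by simp next case 2 then show ?case by (simp add: skein.span_zero) }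
next
  case (sym \<beta> \<gamma>)
  { case 1 then show ?case using sym by blast
  next
    case 2
    then have "braid_diagram (u @ \<beta> @ w) - braid_diagram (u @ \<gamma> @ w) \<in> relations" using sym by simp
    then show ?case using skein.span_neg by fastforce }
next
  case (trans \<alpha> \<beta> \<gamma>)
  { case 1 then show ?case using trans by blast
  next
    case 2
    then have "braid_diagram (u @ \<alpha> @ w) - braid_diagram (u @ \<beta> @ w) \<in> relations"
      "braid_diagram (u @ \<beta> @ w) - braid_diagram (u @ \<gamma> @ w) \<in> relations" using trans by simp_all
    then show ?case using skein.span_add by fastforce }
next
  case (inside \<beta> \<gamma> u' w')
  { case 1 then show ?case using inside by auto
  next
    case 2 then show ?case using inside.IH(2)[of "u @ u'" "w' @ w"] by simp }
next
  case far
  { case 1 then show ?case by simp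
  next
    case 2
    then show ?case using isotopy_move.far[of "Sig (k + 1)" "Sig (k + 3)"]
      by (intro isotopy_move_relation) (simp_all add: braid_at_def add.commute) }
next
  case braid_12
  { case 1 then show ?case by auto
  next
    case 2
    then show ?case using isotopy_move.R3[of "k + 1"]
      by (intro isotopy_move_relation) (simp_all add: braid_at_def) }
next
  case braid_23
  { case 1 then show ?case by auto
  next
    case 2
    then show ?case using isotopy_move.R3[of "k + 2"]
      by (intro isotopy_move_relation) (simp_all add: braid_at_def numeral_eq_Suc) }
qed

text \<open>
  The contribution of the crossing of the branches \<open>a < b\<close> at the position \<open>s\<close> of the braid word,
  where \<open>t\<close> is the position of \<open>d\<close>: on the over branch \<open>high\<close> of \<open>d\<close> itself the positions
  decide which of the two crossings is met first.
\<close>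

definition f_weight :: "endpoint set \<Rightarrow> nat \<Rightarrow> nat \<Rightarrow> nat \<Rightarrow> nat \<Rightarrow> nat \<Rightarrow> int" where
  "f_weight A high t s a b = of_bool (E a < E b \<and>
     (if a = high then s < t else E a < E high) \<and> branch_grading a b = A)"

section \<open>Comparison of \<open>W\<close> along the meridian\<close>

lemma f_weight_other_branch: "a \<noteq> high \<Longrightarrow> f_weight A high t s a b = f_weight A high 0 0 a b"
  by (simp add: f_weight_def)

text \<open>Times of entry of different branches are at least six apart, so the offsets decide only
  when the under branch of the letter is \<open>high\<close> itself.\<close>

lemma W_branches:
  assumes br: "branches u i w low mid high" and type0: "E high < E low"
  defines "\<beta> \<equiv> u @ [i, i + 1, i] @ w"
  shows "W C A (triple u i w) = outer_W A high +
    (\<Sum>s<6. f_weight A high (length u + 1) s (lower \<beta> s) (upper \<beta> s))"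
proof -
  have \<beta>: "half_twist_word \<beta>" and high: "high \<in> {1..4}"
    using br by (simp_all add: branches_def \<beta>_def)
  then have "length u + 1 < 6" by (simp add: half_twist_word_def \<beta>_def)
  then have "E (lower \<beta> s) + s < E high + (length u + 1) \<longleftrightarrow>
      (if lower \<beta> s = high then s < length u + 1 else E (lower \<beta> s) < E high)" if "s < 6" for s
    using E_separated[OF track_lower_upper(1)[OF \<beta> that] high] that by auto
  then show ?thesis
    unfolding W_triple[OF br type0] \<beta>_def[symmetric] f_weight_def
    by (intro arg_cong2[where f = "(+)"] sum.cong) auto
qed

text \<open>The eight moves form four pairs with equal branches, in each pair the move of sign 1
  before the one of sign -1.\<close>

lemma meridian_branches:
  "branches [] 1 [3, 2, 1] 1 2 3" "branches [3, 2, 1] 2 [] 1 2 3"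
  "branches [2, 1] 2 [1] 1 2 4" "branches [3] 1 [3, 2] 1 2 4"
  "branches [2, 3] 1 [3] 1 3 4" "branches [1] 2 [1, 2] 1 3 4"
  "branches [] 2 [1, 2, 3] 2 3 4" "branches [1, 2, 3] 1 [] 2 3 4"
  by (auto simp: branches_def half_twist_word_def transpose_def)

text \<open>For an uninterpreted \<open>g\<close> this tabulates the under and over branch of every
  letter of the eight words. The sums \<open>1 + 1\<close> and \<open>2 + 1\<close> are kept to
  match \<open>W_branches\<close>.\<close>

lemma sum_crossings:
  fixes g :: "nat \<Rightarrow> nat \<Rightarrow> nat \<Rightarrow> int"
  shows
  "(\<Sum>s<6. g s (lower ([] @ [1, 1 + 1, 1] @ [3, 2, 1]) s) (upper ([] @ [1, 1 + 1, 1] @ [3, 2, 1]) s)) =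
     g 0 1 2 + g 1 1 3 + g 2 2 3 + g 3 1 4 + g 4 2 4 + g 5 3 4"
    and
  "(\<Sum>s<6. g s (lower ([3, 2, 1] @ [2, 2 + 1, 2] @ []) s) (upper ([3, 2, 1] @ [2, 2 + 1, 2] @ []) s)) =
     g 0 3 4 + g 1 2 4 + g 2 1 4 + g 3 1 2 + g 4 1 3 + g 5 2 3"
    and
  "(\<Sum>s<6. g s (lower ([2, 1] @ [2, 2 + 1, 2] @ [1]) s) (upper ([2, 1] @ [2, 2 + 1, 2] @ [1]) s)) =
     g 0 2 3 + g 1 1 3 + g 2 1 2 + g 3 1 4 + g 4 2 4 + g 5 3 4"
    and
  "(\<Sum>s<6. g s (lower ([3] @ [1, 1 + 1, 1] @ [3, 2]) s) (upper ([3] @ [1, 1 + 1, 1] @ [3, 2]) s)) =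
     g 0 3 4 + g 1 1 2 + g 2 1 4 + g 3 2 4 + g 4 1 3 + g 5 2 3"
    and
  "(\<Sum>s<6. g s (lower ([2, 3] @ [1, 1 + 1, 1] @ [3]) s) (upper ([2, 3] @ [1, 1 + 1, 1] @ [3]) s)) =
     g 0 2 3 + g 1 2 4 + g 2 1 3 + g 3 1 4 + g 4 3 4 + g 5 1 2"
    and
  "(\<Sum>s<6. g s (lower ([1] @ [2, 2 + 1, 2] @ [1, 2]) s) (upper ([1] @ [2, 2 + 1, 2] @ [1, 2]) s)) =
     g 0 1 2 + g 1 1 3 + g 2 1 4 + g 3 3 4 + g 4 2 4 + g 5 2 3"
    and
  "(\<Sum>s<6. g s (lower ([] @ [2, 2 + 1, 2] @ [1, 2, 3]) s) (upper ([] @ [2, 2 + 1, 2] @ [1, 2, 3]) s)) =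
     g 0 2 3 + g 1 2 4 + g 2 3 4 + g 3 1 4 + g 4 1 3 + g 5 1 2"
    and
  "(\<Sum>s<6. g s (lower ([1, 2, 3] @ [1, 1 + 1, 1] @ []) s) (upper ([1, 2, 3] @ [1, 1 + 1, 1] @ []) s)) =
     g 0 1 2 + g 1 1 3 + g 2 1 4 + g 3 2 3 + g 4 2 4 + g 5 3 4"
  by (simp_all add: lower_def upper_def transpose_def numeral_eq_Suc)

text \<open>The over branch of \<open>d\<close> is 3, which is the under branch only at its crossing
  with 4. Counting from 0, that crossing is letter 5 of the first word, after \<open>d\<close> at 1,
  and letter 0 of the second, before \<open>d\<close> at 4.\<close>

lemma W_123:
  assumes "E 3 < E 1"
  shows "W C A (triple [3, 2, 1] 2 []) =
    W C A (triple [] 1 [3, 2, 1]) + of_bool (E 3 < E 4 \<and> branch_grading 3 4 = A)"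
proof -
  have "f_weight A 3 t s 3 4 = (if s < t then of_bool (E 3 < E 4 \<and> branch_grading 3 4 = A) else 0)" for s t
    by (simp add: f_weight_def)
  \<comment> \<open>For under branches other than 3 the positions are immaterial, so their weights
    are normalised to \<open>0 0\<close> and agree in both words.\<close>
  then show ?thesis
    unfolding W_branches[OF meridian_branches(1) assms] sum_crossings(1)[of "f_weight A 3 (length ([] :: nat list) + 1)"]
      W_branches[OF meridian_branches(2) assms] sum_crossings(2)[of "f_weight A 3 (length ([3, 2, 1] :: nat list) + 1)"]
    by (simp add: f_weight_other_branch[of _ _ _ "Suc _"] f_weight_other_branch[of _ _ _ "numeral _"])
qed

text \<open>Branch 4 is never an under branch, so the positions of the letters do not count and all
  four words give the same sum over pairs of branches. The reason is the same in
  \<open>W_234\<close>.\<close>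

lemma W_14:
  assumes "E 4 < E 1"
  shows "W C A (triple [3] 1 [3, 2]) = W C A (triple [2, 1] 2 [1])"
    and "W C A (triple [2, 3] 1 [3]) = W C A (triple [2, 1] 2 [1])"
    and "W C A (triple [1] 2 [1, 2]) = W C A (triple [2, 1] 2 [1])"
  unfolding W_branches[OF meridian_branches(3) assms] sum_crossings(3)[of "f_weight A 4 (length ([2, 1] :: nat list) + 1)"]
    W_branches[OF meridian_branches(4) assms] sum_crossings(4)[of "f_weight A 4 (length ([3] :: nat list) + 1)"]
    W_branches[OF meridian_branches(5) assms] sum_crossings(5)[of "f_weight A 4 (length ([2, 3] :: nat list) + 1)"]
    W_branches[OF meridian_branches(6) assms] sum_crossings(6)[of "f_weight A 4 (length ([1] :: nat list) + 1)"]
  by (simp_all add: f_weight_other_branch[of _ _ _ "Suc _"] f_weight_other_branch[of _ _ _ "numeral _"])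

lemma W_234:
  assumes "E 4 < E 2"
  shows "W C A (triple [1, 2, 3] 1 []) = W C A (triple [] 2 [1, 2, 3])"
  unfolding W_branches[OF meridian_branches(7) assms] sum_crossings(7)[of "f_weight A 4 (length ([] :: nat list) + 1)"]
    W_branches[OF meridian_branches(8) assms] sum_crossings(8)[of "f_weight A 4 (length ([1, 2, 3] :: nat list) + 1)"]
  by (simp add: f_weight_other_branch[of _ _ _ "Suc _"] f_weight_other_branch[of _ _ _ "numeral _"])

section \<open>The cochain before passing to classes\<close>

definition R_sum :: "endpoint set \<Rightarrow> combination" where
  "R_sum A =
     (\<Sum>(s, p)\<leftarrow>filter (\<lambda>(s, p). (type_lc C p \<or> type_ra C p) \<and> hm_grading C p = A) (meridian L k U).
        scale (of_int s) (resolved p [2, 1])) +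
     (\<Sum>(s, p)\<leftarrow>filter (\<lambda>(s, p). d_type0 C p) (meridian L k U).
        scale (of_int (s * W C A p)) (resolved p [2, 2] - resolved p [1, 1]))"

text \<open>Turns the filters into coefficients, so that terms selected by different conditions can
  be collected.\<close>

lemma scale_if: "(if P then scale r x else 0) = scale (of_bool P * r) x"
  by simp

lemma resolved_triple:
  assumes "1 \<le> i"
  shows "resolved (triple u i w) \<gamma> = braid_diagram (u @ map (\<lambda>a. i - 1 + a) \<gamma> @ w)"
  by (simp add: resolved_def plug_triple[OF assms] braid_diagram_def)

text \<open>The selecting conditions depend only on the branches. Hence the moves of a pair share
  the coefficient \<open>t\<close>, while each \<open>c\<close> still carries its own value of
  \<open>W\<close>.\<close>

lemma R_sum_eq:
  fixes A :: "endpoint set"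
  defines "t \<equiv> \<lambda>low mid high. of_bool (E mid < E low \<and> E mid < E high \<and> branch_grading mid high = A) :: laurent"
    and "c \<equiv> \<lambda>low high u i w. of_bool (E high < E low) * of_int (W C A (triple u i w)) :: laurent"
  shows "R_sum A =
     scale (t 1 2 3) (braid_diagram [2, 1, 3, 2, 1] - braid_diagram [3, 2, 1, 3, 2]) +
     scale (t 1 2 4) (braid_diagram [2, 1, 3, 2, 1] - braid_diagram [3, 2, 1, 3, 2]) +
     scale (t 1 3 4) (braid_diagram [2, 3, 2, 1, 3] - braid_diagram [1, 3, 2, 1, 2]) +
     scale (t 2 3 4) (braid_diagram [3, 2, 1, 2, 3] - braid_diagram [1, 2, 3, 2, 1]) +
     (scale (c 1 3 [] 1 [3, 2, 1]) (braid_diagram [2, 2, 3, 2, 1] - braid_diagram [1, 1, 3, 2, 1]) -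
      scale (c 1 3 [3, 2, 1] 2 []) (braid_diagram [3, 2, 1, 3, 3] - braid_diagram [3, 2, 1, 2, 2])) +
     (scale (c 1 4 [2, 1] 2 [1]) (braid_diagram [2, 1, 3, 3, 1] - braid_diagram [2, 1, 2, 2, 1]) -
      scale (c 1 4 [3] 1 [3, 2]) (braid_diagram [3, 2, 2, 3, 2] - braid_diagram [3, 1, 1, 3, 2])) +
     (scale (c 1 4 [2, 3] 1 [3]) (braid_diagram [2, 3, 2, 2, 3] - braid_diagram [2, 3, 1, 1, 3]) -
      scale (c 1 4 [1] 2 [1, 2]) (braid_diagram [1, 3, 3, 1, 2] - braid_diagram [1, 2, 2, 1, 2])) +
     (scale (c 2 4 [] 2 [1, 2, 3]) (braid_diagram [3, 3, 1, 2, 3] - braid_diagram [2, 2, 1, 2, 3]) -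
      scale (c 2 4 [1, 2, 3] 1 []) (braid_diagram [1, 2, 3, 2, 2] - braid_diagram [1, 2, 3, 1, 1]))"
  unfolding R_sum_def meridian_def move_triple sum_list_map_filter' list.map sum_list.Cons sum_list.Nil
    prod.case scale_if t_def c_def
    meridian_branches[THEN type_lc_or_ra] meridian_branches[THEN d_type0_iff]
    meridian_branches[THEN hm_grading_triple]
  by (simp add: resolved_triple numeral_2_eq_2[symmetric] skein.scale_right_diff_distrib conj_assoc
      split del: if_split split_of_bool)

lemma equiv_relation:
  assumes "braid_equiv \<beta> \<gamma>" "set \<beta> \<subseteq> {1, 2, 3}"
  shows "braid_diagram \<beta> - braid_diagram \<gamma> \<in> relations"
  using braid_equiv_relation(2)[OF assms(1), of "[]" "[]"] assms(2) by simp

lemma R_sum_relations: "R_sum A \<in> relations"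
proof -
  let ?D = braid_diagram
  define t where "t low mid high = (of_bool (E mid < E low \<and> E mid < E high \<and>
    branch_grading mid high = A) :: laurent)" for low mid high
  define c where "c low high u i w = (of_bool (E high < E low) * of_int (W C A (triple u i w)) :: laurent)"
    for low high u i w
  define c1 where "c1 = c 1 3 [] 1 [3, 2, 1]"
  define c2 where "c2 = c 1 4 [2, 1] 2 [1]"
  define c3 where "c3 = c 2 4 [] 2 [1, 2, 3]"
  \<comment> \<open>The condition for the defect in \<open>W_123\<close>, together with
    \<open>E 3 < E 1\<close>, is the one that selects the first-sum terms of 134.\<close>
  have c1': "c 1 3 [3, 2, 1] 2 [] = c1 + t 1 3 4"
    using W_123 by (simp add: c1_def c_def t_def of_bool_conj distrib_left)
  have c2': "c 1 4 [3] 1 [3, 2] = c2" "c 1 4 [2, 3] 1 [3] = c2" "c 1 4 [1] 2 [1, 2] = c2"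
    using W_14 by (simp_all add: c2_def c_def)
  have c3': "c 2 4 [1, 2, 3] 1 [] = c3"
    using W_234 by (simp add: c3_def c_def)
  \<comment> \<open>The defect of 123 is merged with the first-sum difference of 134, and the 124
    and 134 terms are collected under \<open>c2\<close>. Each bracket then consists of differences
    of equivalent words.\<close>
  have "R_sum A =
      scale (t 1 2 3) (?D [2, 1, 3, 2, 1] - ?D [3, 2, 1, 3, 2]) +
      scale (t 1 2 4) (?D [2, 1, 3, 2, 1] - ?D [3, 2, 1, 3, 2]) +
      scale (t 2 3 4) (?D [3, 2, 1, 2, 3] - ?D [1, 2, 3, 2, 1]) +
      scale (t 1 3 4) ((?D [2, 3, 2, 1, 3] - ?D [3, 2, 1, 3, 3]) - (?D [1, 3, 2, 1, 2] - ?D [3, 2, 1, 2, 2])) +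
      scale c1 ((?D [2, 2, 3, 2, 1] - ?D [3, 2, 1, 3, 3]) - (?D [1, 1, 3, 2, 1] - ?D [3, 2, 1, 2, 2])) +
      scale c2 ((?D [2, 1, 3, 3, 1] - ?D [2, 3, 1, 1, 3]) - (?D [2, 1, 2, 2, 1] - ?D [1, 2, 2, 1, 2]) -
        ((?D [3, 2, 2, 3, 2] - ?D [2, 3, 2, 2, 3]) - (?D [3, 1, 1, 3, 2] - ?D [1, 3, 3, 1, 2]))) +
      scale c3 ((?D [3, 3, 1, 2, 3] - ?D [1, 2, 3, 2, 2]) - (?D [2, 2, 1, 2, 3] - ?D [1, 2, 3, 1, 1]))"
    unfolding R_sum_eq t_def[symmetric] c_def[symmetric] c1' c2' c3'
      c1_def[symmetric] c2_def[symmetric] c3_def[symmetric]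
    by (simp only: skein.scale_right_diff_distrib skein.scale_right_distrib skein.scale_left_distrib)
      (simp only: algebra_simps)
  also have "\<dots> \<in> relations"
    by (intro skein.span_add skein.span_scale
        equiv_relation[OF equiv_21321] equiv_relation[OF equiv_32123]
        skein.span_diff[OF equiv_relation[OF equiv_23213] equiv_relation[OF equiv_13212]]
        skein.span_diff[OF equiv_relation[OF braid_equiv.trans[OF equiv_22321 equiv_23213]]
          equiv_relation[OF braid_equiv.trans[OF equiv_11321 equiv_13212]]]
        skein.span_diff[OF
          skein.span_diff[OF equiv_relation[OF equiv_21331] equiv_relation[OF equiv_21221]]
          skein.span_diff[OF equiv_relation[OF equiv_32232] equiv_relation[OF equiv_31132]]]
        skein.span_diff[OF equiv_relation[OF equiv_33123] equiv_relation[OF equiv_22123]])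
      simp_all
  finally show ?thesis .
qed

end

section \<open>From relations to classes in the skein module\<close>

lemma subspace_free_module: "skein.subspace (free_module a b)"
  by (rule skein.subspaceI)
    (auto simp: free_module_def in_keys_iff lookup_add lookup_scale subset_iff,
      metis add.right_neutral, metis mult_zero_right)

lemma insert_in_free_module:
  assumes "\<forall>(c, w) \<in> set r. pre @ w @ post \<in> diagrams a b"
  shows "insert_in pre post r \<in> free_module a b"
  using assms
proof (induction r)
  case Nil
  then show ?case by (simp add: insert_in_def skein.subspace_0[OF subspace_free_module])
next
  case (Cons p r)
  obtain c w where p: "p = (c, w)" by (cases p)
  have "Poly_Mapping.single (pre @ w @ post) c \<in> free_module a b"
    using Cons.prems by (simp add: p free_module_def)
  then have "Poly_Mapping.single (pre @ w @ post) c + insert_in pre post r \<in> free_module a b"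
    using Cons by (intro skein.subspace_add[OF subspace_free_module]) auto
  then show ?case by (simp add: insert_in_def p)
qed

text \<open>\<open>skein_equiv\<close> relates only elements of the free module, and any other
  element would have an empty class. So relations must be seen to lie in it before their class is
  compared with that of 0.\<close>

lemma span_relators_free_module: "skein.span (skein_relators a b) \<subseteq> free_module a b"
proof (rule skein.span_minimal[OF _ subspace_free_module])
  show "skein_relators a b \<subseteq> free_module a b"
    using insert_in_free_module by (auto simp: skein_relators_def)
qed

lemma skein_class_relation:
  assumes "x \<in> skein.span (skein_relators a b)"
  shows "skein_class a b x = skein_class a b 0"
proof -
  have "x - y \<in> skein.span (skein_relators a b) \<longleftrightarrow> 0 - y \<in> skein.span (skein_relators a b)" for y
    using skein.span_diff[OF _ assms, of "x - y"] skein.span_add[OF assms, of "0 - y"] by auto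
  moreover have "x \<in> free_module a b" "0 \<in> free_module a b"
    using assms span_relators_free_module skein.subspace_0[OF subspace_free_module] by blast+
  ultimately show ?thesis by (simp add: skein_class_def skein_equiv_def)
qed

theorem proposition8:
  fixes n k :: nat and C :: closing and L U :: diagram and A :: "endpoint set"
  assumes "string_link n C (half_twist L k U)"
    and "closes_to_circle C (half_twist L k U)"
    and "positive_quadruple_crossing C L k U"
    and "grading C (half_twist L k U) A"
  shows "R_F_reg C (meridian L k U) A = skein_class (tops C) (bots C) 0"
proof -
  interpret quadruple_crossing n C L k U
    using assms(1-3) by unfold_locales
  show ?thesis
    using skein_class_relation[OF R_sum_relations] by (simp add: R_F_reg_def R_sum_def)
qed

end
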